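(* Let $\alpha\in[\frac12,1]$ and let $A=-\mathcal{A}$ be the opposite of a Sturm-Liouville operator, considered on $X_\alpha=D((\mu I-A)^\alpha)$ with domain $D(A)_\alpha$, with boundary conditions of one of the following types: Dirichlet ($\alpha_a=0=\alpha_b$), Neumann ($\beta_a=0=\beta_b$), or mixed ($\alpha_a\neq0\neq\beta_a$, $\alpha_b\neq0\neq\beta_b$, $\frac{\beta_a}{\alpha_a}<0$, $\frac{\beta_b}{\alpha_b}>0$). Let $\{\phi_n\}_{n\ge1}$ be the eigenfunctions of $A$. Let $\eta\in[a,b]$ and let $C:X_\alpha\to\mathbb{R}$ be the point observation operator $Cx=x(\eta)$. Then the pair $(C,A)$ is approximately observable in infinite time on $X_\alpha$ if and only if $\phi_n(\eta)\neq0$ for all $n\geq1$.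
   Context: Let $a<b$ be real. Let $p,\frac{dp}{dz},q,\rho$ be real-valued continuous functions on $[a,b]$ with $\rho>0$ and $p>0$. $X=L^2_\rho(a,b)$ denotes the space $L^2(a,b)$ of real-valued square integrable functions equipped with the inner product $\langle f,g\rangle_\rho=\int_a^b f(z)g(z)\rho(z)\,dz$. The Sturm-Liouville operator is $(\mathcal{A}f)(z)=\frac{1}{\rho(z)}\left(\frac{d}{dz}\left(-p(z)\frac{df}{dz}(z)\right)+q(z)f(z)\right)$ with domain $D(\mathcal{A})=\{f\in H^2(a,b):\ \alpha_a\frac{df}{dz}(a)+\beta_a f(a)=0=\alpha_b\frac{df}{dz}(b)+\beta_b f(b)\}$, where $(\alpha_a,\beta_a)\neq(0,0)\neq(\alpha_b,\beta_b)$ are real pairs. Put $A=-\mathcal{A}$, $D(A)=D(\mathcal{A})$. Known facts: $A$ is self-adjoint on $X$; its spectrum consists only of simple real eigenvalues $\{\lambda_n\}_{n\in\mathbb{N}}$, bounded from above; the normalized eigenfunctions $\{\phi_n\}_{n\in\mathbb{N}}$ form an orthonormal basis of $X$; and $Af=\sum_{n=1}^\infty\lambda_n\langle f,\phi_n\rangle_\rho\phi_n$ for $f\in D(A)=\{f\in X:\ \sum_{n=1}^\infty\lambda_n^2\langle f,\phi_n\rangle_\rho^2<\infty\}$. Fix $\mu=\gamma+\epsilon$ with $\epsilon>0$ and $\lambda_n<\gamma<\infty$ for all $n$, chosen moreover such that $\mu>-q_*/\rho_*$, where $q_*=\min_{[a,b]}q$ and $\rho_*=\min_{[a,b]}\rho$.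 For $\alpha>0$, $(\mu I-A)^\alpha f=\sum_{n=1}^\infty(\mu-\lambda_n)^\alpha\langle f,\phi_n\rangle_\rho\phi_n$ with domain $X_\alpha:=D((\mu I-A)^\alpha)=\{f\in X:\ \sum_{n=1}^\infty(\mu-\lambda_n)^{2\alpha}\langle f,\phi_n\rangle_\rho^2<\infty\}$, a real Hilbert space for $\langle f,g\rangle_\alpha=\langle(\mu I-A)^\alpha f,(\mu I-A)^\alpha g\rangle_\rho$. Put $\phi_{n,\alpha}=(\mu-\lambda_n)^{-\alpha}\phi_n$. On $X_\alpha$ the operator $A$ is considered with domain $D(A)_\alpha=\{f\in X_\alpha:\ \sum_{n=1}^\infty\lambda_n^2\langle f,\phi_{n,\alpha}\rangle_\alpha^2<\infty\}$, where $Af=\sum_{n=1}^\infty\lambda_n\langle f,\phi_{n,\alpha}\rangle_\alpha\phi_{n,\alpha}$; it generates a $C_0$-semigroup $(T(t))_{t\ge0}$ on $X_\alpha$. For $\alpha\in[\frac12,1]$, under the boundary conditions in the claim, elements of $X_\alpha$ belong to $H^1(a,b)$, and $x(\eta)$ denotes the value at $\eta$ of the continuous representative of $x$. The pair $(C,A)$ is approximately observable on $[0,\tau]$ if, for $x_0\in X_\alpha$, $CT(t)x_0=0$ for all $t\in[0,\tau]$ implies $x_0=0$. It is approximately observable in infinite time if it is approximately observable on $[0,\tau]$ for all $\tau>0$. *)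

theory Defs
  imports "HOL-Analysis.Analysis"
begin

text \<open>
  Elements of \<open>L\<^sup>2(a,b)\<close> are represented by functions on \<open>\<real>\<close>, of which only the restriction to
  \<open>[a,b]\<close> matters, and equality of elements is equality almost everywhere on \<open>[a,b]\<close>.
  Sequences are indexed from \<open>0\<close> instead of \<open>1\<close>.
\<close>

definition ae_eq :: "real \<Rightarrow> real \<Rightarrow> (real \<Rightarrow> real) \<Rightarrow> (real \<Rightarrow> real) \<Rightarrow> bool" where
  "ae_eq a b f g \<longleftrightarrow> (AE z in lebesgue_on {a..b}. f z = g z)"

definition L2 :: "real \<Rightarrow> real \<Rightarrow> (real \<Rightarrow> real) set" where
  "L2 a b = {f. f \<in> borel_measurable (lebesgue_on {a..b}) \<and>
                integrable (lebesgue_on {a..b}) (\<lambda>z. (f z)\<^sup>2)}"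

definition ip_rho :: "real \<Rightarrow> real \<Rightarrow> (real \<Rightarrow> real) \<Rightarrow> (real \<Rightarrow> real) \<Rightarrow> (real \<Rightarrow> real) \<Rightarrow> real" where
  "ip_rho a b \<rho> f g = (LINT z|lebesgue_on {a..b}. f z * g z * \<rho> z)"

definition norm_rho :: "real \<Rightarrow> real \<Rightarrow> (real \<Rightarrow> real) \<Rightarrow> (real \<Rightarrow> real) \<Rightarrow> real" where
  "norm_rho a b \<rho> f = sqrt (ip_rho a b \<rho> f f)"

definition sums_in_norm ::
    "((real \<Rightarrow> real) \<Rightarrow> real) \<Rightarrow> (nat \<Rightarrow> real \<Rightarrow> real) \<Rightarrow> (real \<Rightarrow> real) \<Rightarrow> bool" where
  "sums_in_norm nrm u f \<longleftrightarrow> (\<lambda>N. nrm (\<lambda>z. (\<Sum>n<N. u n z) - f z)) \<longlonglongrightarrow> 0"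

definition orthonormal_basis_rho ::
    "real \<Rightarrow> real \<Rightarrow> (real \<Rightarrow> real) \<Rightarrow> (nat \<Rightarrow> real \<Rightarrow> real) \<Rightarrow> bool" where
  "orthonormal_basis_rho a b \<rho> \<phi> \<longleftrightarrow>
     (\<forall>n. \<phi> n \<in> L2 a b) \<and>
     (\<forall>m n. ip_rho a b \<rho> (\<phi> m) (\<phi> n) = (if m = n then 1 else 0)) \<and>
     (\<forall>f\<in>L2 a b. sums_in_norm (norm_rho a b \<rho>) (\<lambda>n z. ip_rho a b \<rho> f (\<phi> n) * \<phi> n z) f)"


section \<open>The Sturm--Liouville operator\<close>

text \<open>
  In one dimension, \<open>H\<^sup>1(a,b)\<close> consists of the absolutely continuous functions with derivative in
  \<open>L\<^sup>2(a,b)\<close>, that is, of the indefinite integrals of \<open>L\<^sup>2\<close> functions.  Elements of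
  \<open>H\<^sup>1\<close> and \<open>H\<^sup>2\<close> are taken to be their continuous, respectively \<open>C\<^sup>1\<close>, representatives on
  \<open>[a,b]\<close>, so that boundary values and point values are ordinary function values.
\<close>

definition has_L2_deriv :: "real \<Rightarrow> real \<Rightarrow> (real \<Rightarrow> real) \<Rightarrow> (real \<Rightarrow> real) \<Rightarrow> bool" where
  "has_L2_deriv a b f g \<longleftrightarrow>
     g \<in> L2 a b \<and> (\<forall>x\<in>{a..b}. f x = f a + (LINT z|lebesgue_on {a..x}. g z))"

definition H1 :: "real \<Rightarrow> real \<Rightarrow> (real \<Rightarrow> real) set" where
  "H1 a b = {f. \<exists>g. has_L2_deriv a b f g}"

definition L2_deriv :: "real \<Rightarrow> real \<Rightarrow> (real \<Rightarrow> real) \<Rightarrow> real \<Rightarrow> real" where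
  "L2_deriv a b f = (SOME g. has_L2_deriv a b f g)"

text \<open>The classical derivative on \<open>[a,b]\<close>, one-sided at the end points.\<close>

definition deriv_on :: "real \<Rightarrow> real \<Rightarrow> (real \<Rightarrow> real) \<Rightarrow> real \<Rightarrow> real" where
  "deriv_on a b f z = vector_derivative f (at z within {a..b})"

definition H2 :: "real \<Rightarrow> real \<Rightarrow> (real \<Rightarrow> real) set" where
  "H2 a b = {f. (\<forall>z\<in>{a..b}. f differentiable (at z within {a..b})) \<and> deriv_on a b f \<in> H1 a b}"

definition SL_coefficients ::
    "real \<Rightarrow> real \<Rightarrow> (real \<Rightarrow> real) \<Rightarrow> (real \<Rightarrow> real) \<Rightarrow> (real \<Rightarrow> real) \<Rightarrow> bool" where
  "SL_coefficients a b p q \<rho> \<longleftrightarrow>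
     a < b \<and>
     (\<forall>z\<in>{a..b}. p differentiable (at z within {a..b})) \<and>
     continuous_on {a..b} (deriv_on a b p) \<and>
     continuous_on {a..b} p \<and> continuous_on {a..b} q \<and> continuous_on {a..b} \<rho> \<and>
     (\<forall>z\<in>{a..b}. 0 < p z) \<and> (\<forall>z\<in>{a..b}. 0 < \<rho> z)"

definition SL_op ::
    "real \<Rightarrow> real \<Rightarrow> (real \<Rightarrow> real) \<Rightarrow> (real \<Rightarrow> real) \<Rightarrow> (real \<Rightarrow> real) \<Rightarrow> (real \<Rightarrow> real) \<Rightarrow> real \<Rightarrow> real"
  where
  "SL_op a b p q \<rho> f z =
     1 / \<rho> z * (L2_deriv a b (\<lambda>y. - p y * deriv_on a b f y) z + q z * f z)"

definition SL_dom :: "real \<Rightarrow> real \<Rightarrow> real \<Rightarrow> real \<Rightarrow> real \<Rightarrow> real \<Rightarrow> (real \<Rightarrow> real) set" where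
  "SL_dom a b \<alpha>a \<beta>a \<alpha>b \<beta>b =
     {f \<in> H2 a b. \<alpha>a * deriv_on a b f a + \<beta>a * f a = 0 \<and> \<alpha>b * deriv_on a b f b + \<beta>b * f b = 0}"

text \<open>\<open>f\<close> is an eigenfunction of \<open>A\<close>, the negative of the Sturm--Liouville operator, for \<open>l\<close>.\<close>

definition eigenfunction_A ::
    "real \<Rightarrow> real \<Rightarrow> (real \<Rightarrow> real) \<Rightarrow> (real \<Rightarrow> real) \<Rightarrow> (real \<Rightarrow> real) \<Rightarrow>
     real \<Rightarrow> real \<Rightarrow> real \<Rightarrow> real \<Rightarrow> real \<Rightarrow> (real \<Rightarrow> real) \<Rightarrow> bool" where
  "eigenfunction_A a b p q \<rho> \<alpha>a \<beta>a \<alpha>b \<beta>b l f \<longleftrightarrow>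
     f \<in> SL_dom a b \<alpha>a \<beta>a \<alpha>b \<beta>b \<and> \<not> ae_eq a b f (\<lambda>_. 0) \<and>
     ae_eq a b (\<lambda>z. - SL_op a b p q \<rho> f z) (\<lambda>z. l * f z)"

definition eigensystem_A ::
    "real \<Rightarrow> real \<Rightarrow> (real \<Rightarrow> real) \<Rightarrow> (real \<Rightarrow> real) \<Rightarrow> (real \<Rightarrow> real) \<Rightarrow>
     real \<Rightarrow> real \<Rightarrow> real \<Rightarrow> real \<Rightarrow> (nat \<Rightarrow> real) \<Rightarrow> (nat \<Rightarrow> real \<Rightarrow> real) \<Rightarrow> bool" where
  "eigensystem_A a b p q \<rho> \<alpha>a \<beta>a \<alpha>b \<beta>b lam \<phi> \<longleftrightarrow>
     inj lam \<and>
     range lam = {l. \<exists>f. eigenfunction_A a b p q \<rho> \<alpha>a \<beta>a \<alpha>b \<beta>b l f} \<and>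
     (\<forall>n. eigenfunction_A a b p q \<rho> \<alpha>a \<beta>a \<alpha>b \<beta>b (lam n) (\<phi> n) \<and> norm_rho a b \<rho> (\<phi> n) = 1)"

definition Dirichlet_bc :: "real \<Rightarrow> real \<Rightarrow> real \<Rightarrow> real \<Rightarrow> bool" where
  "Dirichlet_bc \<alpha>a \<beta>a \<alpha>b \<beta>b \<longleftrightarrow> \<alpha>a = 0 \<and> \<alpha>b = 0"

definition Neumann_bc :: "real \<Rightarrow> real \<Rightarrow> real \<Rightarrow> real \<Rightarrow> bool" where
  "Neumann_bc \<alpha>a \<beta>a \<alpha>b \<beta>b \<longleftrightarrow> \<beta>a = 0 \<and> \<beta>b = 0"

definition mixed_bc :: "real \<Rightarrow> real \<Rightarrow> real \<Rightarrow> real \<Rightarrow> bool" where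
  "mixed_bc \<alpha>a \<beta>a \<alpha>b \<beta>b \<longleftrightarrow>
     \<alpha>a \<noteq> 0 \<and> \<beta>a \<noteq> 0 \<and> \<alpha>b \<noteq> 0 \<and> \<beta>b \<noteq> 0 \<and> \<beta>a / \<alpha>a < 0 \<and> \<beta>b / \<alpha>b > 0"


section \<open>Fractional powers\<close>

definition X_frac ::
    "real \<Rightarrow> real \<Rightarrow> (real \<Rightarrow> real) \<Rightarrow> (nat \<Rightarrow> real) \<Rightarrow> (nat \<Rightarrow> real \<Rightarrow> real) \<Rightarrow> real \<Rightarrow> real \<Rightarrow>
     (real \<Rightarrow> real) set" where
  "X_frac a b \<rho> lam \<phi> \<mu> \<alpha> =
     {f \<in> L2 a b. summable (\<lambda>n. (\<mu> - lam n) powr (2 * \<alpha>) * (ip_rho a b \<rho> f (\<phi> n))\<^sup>2)}"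

text \<open>\<open>(\<mu> I - A)\<^sup>\<alpha> f\<close> for \<open>f\<close> in \<open>X\<^sub>\<alpha>\<close>: the sum of the series in \<open>L\<^sup>2\<close>.\<close>

definition frac_power ::
    "real \<Rightarrow> real \<Rightarrow> (real \<Rightarrow> real) \<Rightarrow> (nat \<Rightarrow> real) \<Rightarrow> (nat \<Rightarrow> real \<Rightarrow> real) \<Rightarrow> real \<Rightarrow> real \<Rightarrow>
     (real \<Rightarrow> real) \<Rightarrow> real \<Rightarrow> real" where
  "frac_power a b \<rho> lam \<phi> \<mu> \<alpha> f =
     (SOME g. g \<in> L2 a b \<and>
        sums_in_norm (norm_rho a b \<rho>)
          (\<lambda>n z. (\<mu> - lam n) powr \<alpha> * ip_rho a b \<rho> f (\<phi> n) * \<phi> n z) g)"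

definition ip_frac ::
    "real \<Rightarrow> real \<Rightarrow> (real \<Rightarrow> real) \<Rightarrow> (nat \<Rightarrow> real) \<Rightarrow> (nat \<Rightarrow> real \<Rightarrow> real) \<Rightarrow> real \<Rightarrow> real \<Rightarrow>
     (real \<Rightarrow> real) \<Rightarrow> (real \<Rightarrow> real) \<Rightarrow> real" where
  "ip_frac a b \<rho> lam \<phi> \<mu> \<alpha> f g =
     ip_rho a b \<rho> (frac_power a b \<rho> lam \<phi> \<mu> \<alpha> f) (frac_power a b \<rho> lam \<phi> \<mu> \<alpha> g)"

definition norm_frac ::
    "real \<Rightarrow> real \<Rightarrow> (real \<Rightarrow> real) \<Rightarrow> (nat \<Rightarrow> real) \<Rightarrow> (nat \<Rightarrow> real \<Rightarrow> real) \<Rightarrow> real \<Rightarrow> real \<Rightarrow>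
     (real \<Rightarrow> real) \<Rightarrow> real" where
  "norm_frac a b \<rho> lam \<phi> \<mu> \<alpha> f = sqrt (ip_frac a b \<rho> lam \<phi> \<mu> \<alpha> f f)"

definition phi_frac ::
    "(nat \<Rightarrow> real) \<Rightarrow> (nat \<Rightarrow> real \<Rightarrow> real) \<Rightarrow> real \<Rightarrow> real \<Rightarrow> nat \<Rightarrow> real \<Rightarrow> real" where
  "phi_frac lam \<phi> \<mu> \<alpha> n z = (\<mu> - lam n) powr (- \<alpha>) * \<phi> n z"

definition dom_A_frac ::
    "real \<Rightarrow> real \<Rightarrow> (real \<Rightarrow> real) \<Rightarrow> (nat \<Rightarrow> real) \<Rightarrow> (nat \<Rightarrow> real \<Rightarrow> real) \<Rightarrow> real \<Rightarrow> real \<Rightarrow>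
     (real \<Rightarrow> real) set" where
  "dom_A_frac a b \<rho> lam \<phi> \<mu> \<alpha> =
     {f \<in> X_frac a b \<rho> lam \<phi> \<mu> \<alpha>.
        summable (\<lambda>n. (lam n)\<^sup>2 * (ip_frac a b \<rho> lam \<phi> \<mu> \<alpha> f (phi_frac lam \<phi> \<mu> \<alpha> n))\<^sup>2)}"

definition A_frac ::
    "real \<Rightarrow> real \<Rightarrow> (real \<Rightarrow> real) \<Rightarrow> (nat \<Rightarrow> real) \<Rightarrow> (nat \<Rightarrow> real \<Rightarrow> real) \<Rightarrow> real \<Rightarrow> real \<Rightarrow>
     (real \<Rightarrow> real) \<Rightarrow> real \<Rightarrow> real" where
  "A_frac a b \<rho> lam \<phi> \<mu> \<alpha> f =
     (SOME g. g \<in> X_frac a b \<rho> lam \<phi> \<mu> \<alpha> \<and>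
        sums_in_norm (norm_frac a b \<rho> lam \<phi> \<mu> \<alpha>)
          (\<lambda>n z. lam n * ip_frac a b \<rho> lam \<phi> \<mu> \<alpha> f (phi_frac lam \<phi> \<mu> \<alpha> n)
                   * phi_frac lam \<phi> \<mu> \<alpha> n z) g)"


section \<open>Semigroups and observability\<close>

text \<open>
  \<open>V\<close> is a space of functions on \<open>[a,b]\<close> modulo equality almost everywhere, with norm \<open>nrm\<close>.
  That each \<open>T t\<close> respects equality almost everywhere follows from linearity and boundedness.
\<close>

definition C0_semigroup ::
    "real \<Rightarrow> real \<Rightarrow> (real \<Rightarrow> real) set \<Rightarrow> ((real \<Rightarrow> real) \<Rightarrow> real) \<Rightarrow>
     (real \<Rightarrow> (real \<Rightarrow> real) \<Rightarrow> real \<Rightarrow> real) \<Rightarrow> bool" where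
  "C0_semigroup a b V nrm T \<longleftrightarrow>
     (\<forall>t\<ge>0. \<forall>x\<in>V. T t x \<in> V) \<and>
     (\<forall>t\<ge>0. \<forall>x\<in>V. \<forall>y\<in>V. \<forall>c d.
        ae_eq a b (T t (\<lambda>z. c * x z + d * y z)) (\<lambda>z. c * T t x z + d * T t y z)) \<and>
     (\<forall>t\<ge>0. \<exists>M. \<forall>x\<in>V. nrm (T t x) \<le> M * nrm x) \<and>
     (\<forall>x\<in>V. ae_eq a b (T 0 x) x) \<and>
     (\<forall>s\<ge>0. \<forall>t\<ge>0. \<forall>x\<in>V. ae_eq a b (T (s + t) x) (T s (T t x))) \<and>
     (\<forall>x\<in>V. ((\<lambda>t. nrm (\<lambda>z. T t x z - x z)) \<longlongrightarrow> 0) (at_right 0))"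

definition generates_C0_semigroup ::
    "real \<Rightarrow> real \<Rightarrow> (real \<Rightarrow> real) set \<Rightarrow> ((real \<Rightarrow> real) \<Rightarrow> real) \<Rightarrow>
     (real \<Rightarrow> real) set \<Rightarrow> ((real \<Rightarrow> real) \<Rightarrow> real \<Rightarrow> real) \<Rightarrow>
     (real \<Rightarrow> (real \<Rightarrow> real) \<Rightarrow> real \<Rightarrow> real) \<Rightarrow> bool" where
  "generates_C0_semigroup a b V nrm D A T \<longleftrightarrow>
     C0_semigroup a b V nrm T \<and>
     (\<forall>x\<in>V. \<forall>y\<in>V.
        ((\<lambda>t. nrm (\<lambda>z. (T t x z - x z) / t - y z)) \<longlongrightarrow> 0) (at_right 0) \<longleftrightarrow>
        x \<in> D \<and> ae_eq a b y (A x))"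

text \<open>The value at \<open>\<eta>\<close> of the continuous representative of \<open>x\<close>.\<close>

definition point_obs :: "real \<Rightarrow> real \<Rightarrow> real \<Rightarrow> (real \<Rightarrow> real) \<Rightarrow> real" where
  "point_obs a b \<eta> x = (THE v. \<exists>g. continuous_on {a..b} g \<and> ae_eq a b x g \<and> v = g \<eta>)"

definition approx_observable_on ::
    "real \<Rightarrow> real \<Rightarrow> (real \<Rightarrow> real) set \<Rightarrow> ((real \<Rightarrow> real) \<Rightarrow> real) \<Rightarrow>
     (real \<Rightarrow> (real \<Rightarrow> real) \<Rightarrow> real \<Rightarrow> real) \<Rightarrow> real \<Rightarrow> bool" where
  "approx_observable_on a b V C T \<tau> \<longleftrightarrow>
     (\<forall>x\<in>V. (\<forall>t\<in>{0..\<tau>}. C (T t x) = 0) \<longrightarrow> ae_eq a b x (\<lambda>_. 0))"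

definition approx_observable_inf ::
    "real \<Rightarrow> real \<Rightarrow> (real \<Rightarrow> real) set \<Rightarrow> ((real \<Rightarrow> real) \<Rightarrow> real) \<Rightarrow>
     (real \<Rightarrow> (real \<Rightarrow> real) \<Rightarrow> real \<Rightarrow> real) \<Rightarrow> bool" where
  "approx_observable_inf a b V C T \<longleftrightarrow> (\<forall>\<tau>>0. approx_observable_on a b V C T \<tau>)"

end

theory Submission
  imports Defs "HOL-Complex_Analysis.Conformal_Mappings"
begin

text \<open>
  Writing \<open>c\<^sub>n\<close> for the Fourier coefficients of \<open>x\<close>, the semigroup acts by
  \<open>c\<^sub>n \<mapsto> exp (\<lambda>\<^sub>n t) c\<^sub>n\<close>.  Integration by parts bounds the supremum of a finite
  combination of eigenfunctions by its norm in \<open>X\<^bsub>1/2\<^esub>\<close>; therefore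
  \<open>\<Sum>\<^sub>n \<phi>\<^sub>n(\<eta>)\<^sup>2 / (\<mu> - \<lambda>\<^sub>n)\<close> converges and the observation is the absolutely convergent series
  \<open>\<Sum>\<^sub>n exp (\<lambda>\<^sub>n t) c\<^sub>n \<phi>\<^sub>n(\<eta>)\<close>.  It extends holomorphically to a half plane, and since
  the \<open>\<lambda>\<^sub>n\<close> are distinct it vanishes on an interval only if every \<open>c\<^sub>n \<phi>\<^sub>n(\<eta>)\<close> is zero.
\<close>

section \<open>Uniqueness for exponential series\<close>

text \<open>The eigenvalues are indexed injectively but in no prescribed order, so the coefficients
  cannot be peeled off one after another starting with the largest exponent. The uniqueness argument
  isolates every index by the same mechanism, and the holomorphic extension is there to reach all
  integer times from a short interval. The semigroup is an arbitrary family satisfying the axioms,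
  and the fractional powers and the operator are Hilbert choices of limits of series. Nothing
  diagonal can be read off from these definitions: completeness of the weighted space has to supply
  the limits, and the action on an eigenfunction has to be recovered from the generator and the
  semigroup law. After that, statements about \<open>T\<close> become statements about coefficients.
  The restriction \<alpha> \<ge> 1/2 places the space inside the form domain, where point evaluation
  is bounded, and the signs in the boundary conditions give this bound without a trace estimate. In
  the converse direction, an eigenfunction that vanishes at \<eta> is itself unobservable.\<close>

lemma exp_series_eq_0_on_halfline:
  fixes d \<nu> :: "nat \<Rightarrow> real"
  assumes d: "summable (\<lambda>n. \<bar>d n\<bar>)" and \<nu>: "\<And>n. 0 \<le> \<nu> n" and \<tau>: "0 < \<tau>"
    and zero: "\<And>t. t \<in> {0..\<tau>} \<Longrightarrow> (\<Sum>n. d n * exp (- \<nu> n * t)) = 0" and t: "0 \<le> t"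
  shows "(\<Sum>n. d n * exp (- \<nu> n * t)) = 0"
proof (cases "t \<le> \<tau>")
  case True
  then show ?thesis using zero t by auto
next
  \<comment> \<open>Here t > \<tau> > 0, so t lies in the open half plane; t = 0, on its boundary,
    belongs to the other case.\<close>
  case False
  define f where "f n z = of_real (d n) * exp (- of_real (\<nu> n) * z)" for n and z :: complex
  define F where "F z = (\<Sum>n. f n z)" for z
  have summ: "summable (\<lambda>n. d n * exp (- \<nu> n * s))" if "s \<ge> 0" for s
    by (rule summable_comparison_test'[OF d, of 0])
       (use that \<nu> in \<open>auto simp: abs_mult intro!: mult_left_le\<close>)
  have F_real: "F (of_real s) = of_real (\<Sum>n. d n * exp (- \<nu> n * s))" if "s \<ge> 0" for s
    unfolding F_def f_def suminf_of_real[OF summ[OF that]] by (simp flip: exp_of_real)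
  \<comment> \<open>For Re z > 0 every exponential has modulus at most 1, because
    \<open>\<nu> n\<close> \<ge> 0; so |d n| is a majorant independent of z.\<close>
  have lim: "uniform_limit {z. 0 < Re z} (\<lambda>n z. \<Sum>i<n. f i z) F sequentially"
    unfolding F_def
  proof (rule Weierstrass_m_test[OF _ d])
    fix n and z :: complex
    assume "z \<in> {z. 0 < Re z}"
    then show "norm (f n z) \<le> \<bar>d n\<bar>"
      using \<nu>[of n] by (auto simp: f_def norm_mult intro!: mult_left_le)
  qed
  have op: "open {z. 0 < Re z}"
    by (simp add: open_halfspace_Re_gt)
  have hol: "F holomorphic_on {z. 0 < Re z}"
  proof (rule holomorphic_uniform_sequence[where f = "\<lambda>n z. \<Sum>i<n. f i z"])
    show "open {z. 0 < Re z}" by (rule op)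
    show "(\<lambda>z. \<Sum>i<n. f i z) holomorphic_on {z. 0 < Re z}" for n
      unfolding f_def by (intro holomorphic_intros)
    fix z assume z: "z \<in> {z. 0 < Re z}"
    obtain r where "r > 0" "cball z r \<subseteq> {z. 0 < Re z}"
      using op z open_contains_cball by blast
    then show "\<exists>d>0. cball z d \<subseteq> {z. 0 < Re z} \<and> uniform_limit (cball z d) (\<lambda>n z. \<Sum>i<n. f i z) F sequentially"
      using lim uniform_limit_on_subset by blast
  qed
  have conn: "connected {z. 0 < Re z}"
    by (simp add: convex_connected convex_halfspace_Re_gt)
  define U where "U = complex_of_real ` {0<..<\<tau>}"
  \<comment> \<open>The real zeros in (0,\<tau>) accumulate at the interior point \<tau>/2, which
    forces F to vanish on the whole connected half plane.\<close>
  have "F (of_real t) = 0"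
  proof (rule analytic_continuation[of F "{z. 0 < Re z}" U "of_real (\<tau>/2)"])
    have "(\<tau>/2) islimpt {0<..<\<tau>}"
      using \<tau> by (intro interior_limit_point) auto
    moreover have "complex_of_real x \<in> ball (complex_of_real (\<tau>/2)) e \<longleftrightarrow> x \<in> ball (\<tau>/2) e" for x e
      unfolding mem_ball dist_of_real ..
    ultimately show "complex_of_real (\<tau>/2) islimpt U"
      unfolding islimpt_approachable U_def
      by (metis (no_types, lifting) dist_of_real image_eqI of_real_eq_iff)
    show "F z = 0" if "z \<in> U" for z
      using that zero F_real unfolding U_def by force
  qed (use op conn hol \<tau> False in \<open>auto simp: U_def\<close>)
  then show ?thesis
    using F_real[OF t] by simp
qed

text \<open>
  At the integers the series becomes a power sum in \<open>y n = exp (- \<nu> n) \<in> (0,1]\<close>; the polynomials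
  \<open>(1 - (y - y m)\<^sup>2)\<^sup>k\<close> converge boundedly on \<open>(0,1]\<close> to the indicator of \<open>{y m}\<close>.
\<close>
lemma exp_series_coeffs_eq_0:
  fixes d \<nu> :: "nat \<Rightarrow> real"
  assumes d: "summable (\<lambda>n. \<bar>d n\<bar>)" and inj: "inj \<nu>" and \<nu>: "\<And>n. 0 \<le> \<nu> n" and \<tau>: "0 < \<tau>"
    and zero: "\<And>t. t \<in> {0..\<tau>} \<Longrightarrow> (\<Sum>n. d n * exp (- \<nu> n * t)) = 0"
  shows "d m = 0"
proof -
  define y where "y n = exp (- \<nu> n)" for n
  have y: "0 < y n" "y n \<le> 1" for n
    using \<nu>[of n] by (auto simp: y_def)
  have summ: "summable (\<lambda>n. d n * y n ^ j)" for j
    by (rule summable_comparison_test'[OF d, of 0])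
       (use y in \<open>auto simp: abs_mult less_imp_le intro!: mult_left_le power_le_one\<close>)
  \<comment> \<open>Sampling at t = j turns exponentials into powers of \<open>y n\<close>. These
    times may exceed \<tau>, whence the extension to the half line.\<close>
  have pow: "(\<Sum>n. d n * y n ^ j) = 0" for j
  proof -
    have "y n ^ j = exp (- \<nu> n * real j)" for n
      by (simp add: y_def flip: exp_of_nat2_mult)
    then show ?thesis
      using exp_series_eq_0_on_halfline[OF d \<nu> \<tau> zero, of "real j"] by simp
  qed
  have poly: "(\<Sum>n. d n * poly P (y n)) = 0" for P
  proof -
    have "(\<lambda>n. \<Sum>j\<le>degree P. coeff P j * (d n * y n ^ j)) sums (\<Sum>j\<le>degree P. coeff P j * 0)"
      by (intro sums_sum sums_mult) (use summ pow in \<open>metis summable_sums\<close>)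
    then have "(\<lambda>n. d n * poly P (y n)) sums 0"
      by (simp add: poly_altdef sum_distrib_left mult_ac)
    then show ?thesis
      by (rule sums_unique[symmetric])
  qed
  define a where "a n k = d n * (1 - (y n - y m)\<^sup>2) ^ k" for n k
  have a0: "(\<Sum>n. a n k) = 0" for k
    using poly[of "([:1:] - [:- y m, 1:]\<^sup>2) ^ k"] by (simp add: a_def)
  \<comment> \<open>Both values lie in (0,1], so they differ by less than 1 and the base of the
    power lies in (0,1]. By injectivity it equals 1 only for n = m.\<close>
  have sq: "(y n - y m)\<^sup>2 \<le> 1" for n
    using y[of n] y[of m] by (simp add: abs_square_le_1)
  have lim: "(\<lambda>k. a n k) \<longlonglongrightarrow> (if n = m then d m else 0)" for n
  proof (cases "n = m")
    case False
    then have "0 < (y n - y m)\<^sup>2"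
      using inj by (simp add: y_def inj_eq)
    then have "norm (1 - (y n - y m)\<^sup>2) < 1"
      using sq[of n] by simp
    then have "(\<lambda>k. (1 - (y n - y m)\<^sup>2) ^ k) \<longlonglongrightarrow> 0"
      by (rule LIMSEQ_power_zero)
    then have "(\<lambda>k. d n * (1 - (y n - y m)\<^sup>2) ^ k) \<longlonglongrightarrow> d n * 0"
      by (intro tendsto_mult tendsto_const)
    with False show ?thesis
      by (simp add: a_def)
  qed (simp add: a_def)
  have bnd: "norm (a n k) \<le> \<bar>d n\<bar>" for n k
  proof -
    have "\<bar>(1 - (y n - y m)\<^sup>2) ^ k\<bar> \<le> 1"
      unfolding power_abs using sq[of n] by (intro power_le_one) auto
    then show ?thesis
      by (simp add: a_def abs_mult mult_left_le)
  qed
  \<comment> \<open>The sums against the polynomials all vanish, while dominated passage to the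
    limit with majorant |d n| leaves only \<open>d m\<close>.\<close>
  have "(\<lambda>k. \<Sum>n. a n k) \<longlonglongrightarrow> (\<Sum>n. if n = m then d m else 0)"
    by (rule tannerys_theorem[OF lim, THEN conjunct2, THEN conjunct2])
       (use bnd d in \<open>auto intro: always_eventually\<close>)
  moreover have "(\<Sum>n. if n = m then d m else 0) = d m"
    by (rule sums_unique[symmetric], rule sums_single)
  ultimately show ?thesis
    using a0 by (simp add: LIMSEQ_const_iff)
qed

section \<open>The weighted \<open>L\<^sup>2\<close> space\<close>

locale weighted_L2 =
  fixes a b :: real and \<rho> :: "real \<Rightarrow> real"
  assumes ab: "a < b" and cont_rho: "continuous_on {a..b} \<rho>"
    and rho_pos: "\<And>z. z \<in> {a..b} \<Longrightarrow> 0 < \<rho> z"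
begin

abbreviation "M \<equiv> lebesgue_on {a..b}"
abbreviation "ip \<equiv> ip_rho a b \<rho>"
abbreviation "nrm \<equiv> norm_rho a b \<rho>"

section \<open>Integrability and the inner product on representatives\<close>

lemma measurable_cont: "continuous_on {a..b} f \<Longrightarrow> f \<in> borel_measurable M" for f :: "real \<Rightarrow> real"
  by (rule continuous_imp_measurable_on_sets_lebesgue) auto

lemma rho_measurable [measurable]: "\<rho> \<in> borel_measurable M"
  by (rule measurable_cont[OF cont_rho])

text \<open>Compactness makes the weight comparable to positive constants, hence the weighted and
  the unweighted norm equivalent.\<close>

lemma rho_bounds:
  obtains r R where "0 < r" "0 < R" "\<And>z. z \<in> {a..b} \<Longrightarrow> r \<le> \<rho> z" "\<And>z. z \<in> {a..b} \<Longrightarrow> \<rho> z \<le> R"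
proof -
  have ne: "{a..b} \<noteq> {}" using ab by auto
  obtain z1 where "z1 \<in> {a..b}" "\<forall>z\<in>{a..b}. \<rho> z1 \<le> \<rho> z"
    using continuous_attains_inf[OF compact_Icc ne cont_rho] by auto
  moreover obtain z2 where "z2 \<in> {a..b}" "\<forall>z\<in>{a..b}. \<rho> z \<le> \<rho> z2"
    using continuous_attains_sup[OF compact_Icc ne cont_rho] by auto
  ultimately show ?thesis
    using rho_pos by (intro that[of "\<rho> z1" "\<rho> z2"]) auto
qed

lemma L2_measurable: "f \<in> L2 a b \<Longrightarrow> f \<in> borel_measurable M"
  by (simp add: L2_def)

lemma L2_mult_integrable:
  assumes "f \<in> L2 a b" "g \<in> L2 a b"
  shows "integrable M (\<lambda>z. f z * g z)"
proof -
  have [measurable]: "f \<in> borel_measurable M" "g \<in> borel_measurable M"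
    using assms by (auto simp: L2_def)
  have bnd: "\<bar>f z * g z\<bar> \<le> (f z)\<^sup>2 + (g z)\<^sup>2" for z
  proof -
    have "2 * (\<bar>f z\<bar> * \<bar>g z\<bar>) \<le> (f z)\<^sup>2 + (g z)\<^sup>2"
      using sum_squares_bound[of "\<bar>f z\<bar>" "\<bar>g z\<bar>"] by (simp add: mult_ac)
    moreover have "0 \<le> \<bar>f z\<bar> * \<bar>g z\<bar>" by simp
    ultimately show ?thesis by (simp only: abs_mult)
  qed
  show ?thesis
  proof (rule Bochner_Integration.integrable_bound[of M "\<lambda>z. (f z)\<^sup>2 + (g z)\<^sup>2"])
    show "integrable M (\<lambda>z. (f z)\<^sup>2 + (g z)\<^sup>2)"
      using assms by (simp add: L2_def)
    show "AE z in M. norm (f z * g z) \<le> norm ((f z)\<^sup>2 + (g z)\<^sup>2)"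
      using bnd by (intro AE_I2) (simp add: order_trans[OF _ abs_ge_self])
  qed simp
qed

lemma ip_integrable:
  assumes "f \<in> L2 a b" "g \<in> L2 a b"
  shows "integrable M (\<lambda>z. f z * g z * \<rho> z)"
proof -
  have [measurable]: "f \<in> borel_measurable M" "g \<in> borel_measurable M"
    using assms by (auto simp: L2_def)
  obtain r R where R: "0 < R" "\<And>z. z \<in> {a..b} \<Longrightarrow> \<rho> z \<le> R"
    using rho_bounds by metis
  show ?thesis
  proof (rule Bochner_Integration.integrable_bound[of M "\<lambda>z. R * (f z * g z)"])
    show "AE z in M. norm (f z * g z * \<rho> z) \<le> norm (R * (f z * g z))"
    proof (rule AE_I2)
      fix z assume "z \<in> space M"
      then have "0 < \<rho> z" "\<rho> z \<le> R" using R rho_pos by auto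
      then have "\<bar>\<rho> z\<bar> \<le> \<bar>R\<bar>" by simp
      then show "norm (f z * g z * \<rho> z) \<le> norm (R * (f z * g z))"
        by (simp add: abs_mult mult_left_mono mult.commute[of "\<bar>R\<bar>"])
    qed
  qed (use L2_mult_integrable[OF assms] in simp_all)
qed

text \<open>The positive lower bound of \<rho> lets the weighted integral dominate the unweighted
  one. The backward direction is what puts the Riesz-Fischer limit into \<open>L2\<close>, since
  Fatou's lemma controls only its weighted norm.\<close>

lemma L2_iff_rho:
  assumes [measurable]: "f \<in> borel_measurable M"
  shows "f \<in> L2 a b \<longleftrightarrow> integrable M (\<lambda>z. (f z)\<^sup>2 * \<rho> z)"
proof
  assume "f \<in> L2 a b" then show "integrable M (\<lambda>z. (f z)\<^sup>2 * \<rho> z)"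
    using ip_integrable[of f f] by (simp add: power2_eq_square)
next
  assume i: "integrable M (\<lambda>z. (f z)\<^sup>2 * \<rho> z)"
  obtain r R where r: "0 < r" "\<And>z. z \<in> {a..b} \<Longrightarrow> r \<le> \<rho> z"
    using rho_bounds by metis
  have "integrable M (\<lambda>z. (f z)\<^sup>2)"
  proof (rule Bochner_Integration.integrable_bound[of M "\<lambda>z. (f z)\<^sup>2 * \<rho> z / r"])
    show "AE z in M. norm ((f z)\<^sup>2) \<le> norm ((f z)\<^sup>2 * \<rho> z / r)"
    proof (rule AE_I2)
      fix z assume "z \<in> space M"
      then have "r \<le> \<rho> z" using r by auto
      then have "(f z)\<^sup>2 * r \<le> (f z)\<^sup>2 * \<rho> z"
        by (rule mult_left_mono) simp
      then show "norm ((f z)\<^sup>2) \<le> norm ((f z)\<^sup>2 * \<rho> z / r)"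
        using \<open>r > 0\<close> \<open>r \<le> \<rho> z\<close> by (simp add: pos_le_divide_eq abs_mult)
    qed
  qed (use i in simp_all)
  then show "f \<in> L2 a b" by (simp add: L2_def)
qed

lemma L2_continuous: "continuous_on {a..b} f \<Longrightarrow> f \<in> L2 a b"
  unfolding L2_def by (auto intro: measurable_cont intro!: continuous_imp_integrable_real continuous_intros)

lemma L2_scale: "f \<in> L2 a b \<Longrightarrow> (\<lambda>z. c * f z) \<in> L2 a b"
  by (auto simp: L2_def power_mult_distrib)

lemma L2_add:
  assumes "f \<in> L2 a b" "g \<in> L2 a b"
  shows "(\<lambda>z. f z + g z) \<in> L2 a b"
proof -
  have "integrable M (\<lambda>z. (f z)\<^sup>2 + (g z)\<^sup>2 + 2 * (f z * g z))"
    using assms L2_mult_integrable[OF assms] by (auto simp: L2_def)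
  moreover have "(\<lambda>z. (f z)\<^sup>2 + (g z)\<^sup>2 + 2 * (f z * g z)) = (\<lambda>z. (f z + g z)\<^sup>2)"
    by (auto simp: power2_sum)
  ultimately show ?thesis
    using assms by (auto simp: L2_def)
qed

lemma L2_lincomb:
  "f \<in> L2 a b \<Longrightarrow> g \<in> L2 a b \<Longrightarrow> (\<lambda>z. c * f z + d * g z) \<in> L2 a b"
  by (intro L2_add L2_scale)

lemma L2_diff: "f \<in> L2 a b \<Longrightarrow> g \<in> L2 a b \<Longrightarrow> (\<lambda>z. f z - g z) \<in> L2 a b"
  using L2_lincomb[of f g 1 "-1"] by simp

lemma L2_sum:
  assumes "\<And>i. i \<in> F \<Longrightarrow> u i \<in> L2 a b"
  shows "(\<lambda>z. \<Sum>i\<in>F. u i z) \<in> L2 a b"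
  using assms
proof (induction F rule: infinite_finite_induct)
  case (insert x F)
  then have "(\<lambda>z. u x z + (\<Sum>i\<in>F. u i z)) \<in> L2 a b"
    by (intro L2_add) auto
  then show ?case using insert by simp
qed (auto simp: L2_def)

lemma ip_commute: "ip f g = ip g f"
  by (simp add: ip_rho_def mult_ac)

lemma ip_lincomb:
  assumes "f \<in> L2 a b" "g \<in> L2 a b" "h \<in> L2 a b"
  shows "ip (\<lambda>z. c * f z + d * g z) h = c * ip f h + d * ip g h"
proof -
  have "ip (\<lambda>z. c * f z + d * g z) h = (LINT z|M. c * (f z * h z * \<rho> z) + d * (g z * h z * \<rho> z))"
    unfolding ip_rho_def by (rule Bochner_Integration.integral_cong) (auto simp: algebra_simps)
  also have "\<dots> = c * ip f h + d * ip g h"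
    using assms unfolding ip_rho_def by (subst Bochner_Integration.integral_add) (auto intro!: ip_integrable)
  finally show ?thesis .
qed

lemma ip_scale: "ip (\<lambda>z. c * f z) g = c * ip f g"
  unfolding ip_rho_def by (simp add: mult.assoc)

lemma ip_diff:
  "f \<in> L2 a b \<Longrightarrow> g \<in> L2 a b \<Longrightarrow> h \<in> L2 a b \<Longrightarrow> ip (\<lambda>z. f z - g z) h = ip f h - ip g h"
  using ip_lincomb[of f g h 1 "-1"] by simp

lemma ip_sum:
  assumes "\<And>i. i \<in> F \<Longrightarrow> u i \<in> L2 a b" "h \<in> L2 a b"
  shows "ip (\<lambda>z. \<Sum>i\<in>F. u i z) h = (\<Sum>i\<in>F. ip (u i) h)"
  unfolding ip_rho_def sum_distrib_right
  using assms by (intro Bochner_Integration.integral_sum ip_integrable)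

lemma ip_self_nonneg: "0 \<le> ip f f"
  unfolding ip_rho_def by (intro integral_nonneg_AE AE_I2) (use rho_pos in \<open>auto simp: less_imp_le\<close>)

lemma nrm_nonneg: "0 \<le> nrm f"
  by (simp add: norm_rho_def ip_self_nonneg)

lemma nrm_sq: "(nrm f)\<^sup>2 = ip f f"
  by (simp add: norm_rho_def ip_self_nonneg)

lemma nrm_eq_0_imp_ae_eq_0:
  assumes f: "f \<in> L2 a b" and "nrm f = 0"
  shows "ae_eq a b f (\<lambda>_. 0)"
proof -
  have "(LINT z|M. f z * f z * \<rho> z) = 0"
    using assms nrm_sq[of f] by (simp add: ip_rho_def)
  then have "AE z in M. f z * f z * \<rho> z = 0"
    using rho_pos by (subst (asm) integral_nonneg_eq_0_iff_AE[OF ip_integrable[OF f f]])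
      (auto simp: less_imp_le intro!: AE_I2)
  moreover have "AE z in M. \<rho> z \<noteq> 0"
    using rho_pos by (intro AE_I2) force
  ultimately show ?thesis
    unfolding ae_eq_def by eventually_elim auto
qed

lemma ip_cong_ae:
  assumes "f \<in> L2 a b" "g \<in> L2 a b" "h \<in> L2 a b" "ae_eq a b f g"
  shows "ip f h = ip g h"
proof -
  note [measurable] = assms(1-3)[THEN L2_measurable]
  have "AE z in M. f z * h z * \<rho> z = g z * h z * \<rho> z"
    using assms(4) unfolding ae_eq_def by eventually_elim auto
  then show ?thesis
    unfolding ip_rho_def by (intro integral_cong_AE) auto
qed

text \<open>Nonnegativity of the quadratic form of s f - t g. Every representative of the zero class
  has \<open>ip f f = 0\<close>, so the discriminant argument treats this degenerate case
  separately.\<close>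

lemma Cauchy_Schwarz:
  assumes f: "f \<in> L2 a b" and g: "g \<in> L2 a b"
  shows "\<bar>ip f g\<bar> \<le> nrm f * nrm g"
proof -
  have q: "0 \<le> s\<^sup>2 * ip f f - 2 * s * t * ip f g + t\<^sup>2 * ip g g" for s t
  proof -
    let ?h = "\<lambda>z. s * f z + (- t) * g z"
    have h: "?h \<in> L2 a b" by (intro L2_lincomb f g)
    have "ip ?h ?h = s * ip f ?h + (- t) * ip g ?h"
      by (rule ip_lincomb[OF f g h])
    also have "ip f ?h = s * ip f f + (- t) * ip g f"
      unfolding ip_commute[of f ?h] by (rule ip_lincomb[OF f g f])
    also have "ip g ?h = s * ip f g + (- t) * ip g g"
      unfolding ip_commute[of g ?h] by (rule ip_lincomb[OF f g g])
    also have "s * (s * ip f f + (- t) * ip g f) + (- t) * (s * ip f g + (- t) * ip g g)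
        = s\<^sup>2 * ip f f - 2 * s * t * ip f g + t\<^sup>2 * ip g g"
      by (simp add: ip_commute[of g f] algebra_simps power2_eq_square)
    finally show ?thesis using ip_self_nonneg[of ?h] by simp
  qed
  have "(ip f g)\<^sup>2 \<le> ip f f * ip g g"
  proof (cases "ip f f = 0")
    case True
    have "ip f g = 0"
    proof (rule ccontr)
      assume ne: "ip f g \<noteq> 0"
      have "0 \<le> (- 2 * s * ip f g) + ip g g" for s
        using q[of s 1] True by simp
      \<comment> \<open>For this s the right-hand side equals -1.\<close>
      from this[of "(ip g g + 1) / (2 * ip f g)"] ne show False
        by (simp add: field_simps)
    qed
    then show ?thesis using True by simp
  next
    case False
    then have pos: "0 < ip f f" using ip_self_nonneg[of f] by simp
    \<comment> \<open>The parameters are s = \<open>ip f g\<close> and t = \<open>ip f f\<close>,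
      whose ratio minimises the quadratic form.\<close>
    have "0 \<le> (ip f g)\<^sup>2 * ip f f - 2 * ip f g * ip f f * ip f g + (ip f f)\<^sup>2 * ip g g"
      by (rule q)
    also have "\<dots> = ip f f * (ip f f * ip g g - (ip f g)\<^sup>2)"
      by (simp add: algebra_simps power2_eq_square)
    finally show ?thesis using pos by (simp add: zero_le_mult_iff)
  qed
  then have "\<bar>ip f g\<bar> \<le> sqrt (ip f f * ip g g)"
    by (metis real_sqrt_le_mono real_sqrt_abs)
  then show ?thesis
    by (simp add: norm_rho_def real_sqrt_mult)
qed

end

section \<open>Orthonormal bases and the Riesz--Fischer theorem\<close>

text \<open>Selects a rapidly convergent subsequence. \<open>E\<close> will bound squared distances,
  so (1/4)^k there means (1/2)^k for the distances, which is summable.\<close>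

lemma eventually_small_monotone_index:
  fixes E :: "nat \<Rightarrow> real"
  assumes "E \<longlonglongrightarrow> 0"
  shows "\<exists>r. mono r \<and> (\<forall>k. k \<le> r k) \<and> (\<forall>k n. r k \<le> n \<longrightarrow> E n \<le> (1/4) ^ k)"
proof -
  have "\<exists>R. \<forall>n\<ge>R. E n \<le> (1/4) ^ k" for k
  proof -
    have "eventually (\<lambda>n. E n < (1/4) ^ k) sequentially"
      using assms by (rule order_tendstoD) simp
    then show ?thesis
      unfolding eventually_sequentially by (meson less_imp_le)
  qed
  then obtain R where R: "\<And>k n. R k \<le> n \<Longrightarrow> E n \<le> (1/4) ^ k"
    by metis
  \<comment> \<open>Summing the \<open>R i\<close> makes \<open>r\<close> monotone while keeping it
    above \<open>R k\<close>; the extra summand k gives \<open>k \<le> r k\<close>.\<close>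
  define r where "r k = k + (\<Sum>i\<le>k. R i)" for k
  have "R k \<le> r k" for k
    by (cases k) (auto simp: r_def)
  moreover have "mono r"
    by (rule monoI) (auto simp: r_def intro!: add_mono sum_mono2)
  moreover have "k \<le> r k" for k
    by (simp add: r_def)
  ultimately show ?thesis
    using R by (meson order_trans)
qed

locale weighted_L2_basis = weighted_L2 +
  fixes \<phi> :: "nat \<Rightarrow> real \<Rightarrow> real"
  assumes basis: "orthonormal_basis_rho a b \<rho> \<phi>"
begin

section \<open>Fourier coefficients and completeness\<close>

definition coef :: "(real \<Rightarrow> real) \<Rightarrow> nat \<Rightarrow> real" where
  "coef f n = ip f (\<phi> n)"

definition psum :: "(nat \<Rightarrow> real) \<Rightarrow> nat \<Rightarrow> real \<Rightarrow> real" where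
  "psum d N z = (\<Sum>n<N. d n * \<phi> n z)"

lemma phi_L2: "\<phi> n \<in> L2 a b"
  and ip_phi: "ip (\<phi> m) (\<phi> n) = (if m = n then 1 else 0)"
  using basis by (auto simp: orthonormal_basis_rho_def)

lemma nrm_phi: "nrm (\<phi> n) = 1"
  by (simp add: norm_rho_def ip_phi)

lemma basis_expansion: "f \<in> L2 a b \<Longrightarrow> (\<lambda>N. nrm (\<lambda>z. psum (coef f) N z - f z)) \<longlonglongrightarrow> 0"
  using basis by (simp add: orthonormal_basis_rho_def sums_in_norm_def psum_def coef_def)

lemma finite_sum_L2: "(\<lambda>z. \<Sum>n\<in>F. d n * \<phi> n z) \<in> L2 a b"
  by (intro L2_sum L2_scale phi_L2)

lemma psum_L2: "psum d N \<in> L2 a b"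
  using finite_sum_L2[of d "{..<N}"] by (simp add: psum_def[abs_def])

lemma coef_phi: "coef (\<phi> n) m = (if n = m then 1 else 0)"
  by (simp add: coef_def ip_phi)

lemma coef_lincomb:
  "f \<in> L2 a b \<Longrightarrow> g \<in> L2 a b \<Longrightarrow> coef (\<lambda>z. c * f z + d * g z) n = c * coef f n + d * coef g n"
  unfolding coef_def by (intro ip_lincomb phi_L2)

lemma coef_scale: "coef (\<lambda>z. c * f z) n = c * coef f n"
  unfolding coef_def by (rule ip_scale)

lemma coef_diff:
  "f \<in> L2 a b \<Longrightarrow> g \<in> L2 a b \<Longrightarrow> coef (\<lambda>z. f z - g z) n = coef f n - coef g n"
  unfolding coef_def by (intro ip_diff phi_L2)

lemma coef_cong_ae:
  "f \<in> L2 a b \<Longrightarrow> g \<in> L2 a b \<Longrightarrow> ae_eq a b f g \<Longrightarrow> coef f n = coef g n"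
  unfolding coef_def by (intro ip_cong_ae phi_L2)

lemma coef_finite_sum:
  assumes "finite F"
  shows "coef (\<lambda>z. \<Sum>n\<in>F. d n * \<phi> n z) m = (if m \<in> F then d m else 0)"
proof -
  have "coef (\<lambda>z. \<Sum>n\<in>F. d n * \<phi> n z) m = (\<Sum>n\<in>F. d n * (if n = m then 1 else 0))"
    unfolding coef_def by (subst ip_sum) (auto intro!: L2_scale phi_L2 simp: ip_scale ip_phi)
  also have "\<dots> = (\<Sum>n\<in>F. if n = m then d n else 0)"
    by (intro sum.cong) auto
  also have "\<dots> = (if m \<in> F then d m else 0)"
    using assms by (simp add: sum.delta)
  finally show ?thesis .
qed

lemma coef_psum: "coef (psum d N) m = (if m < N then d m else 0)"
  using coef_finite_sum[of "{..<N}" d m] by (simp add: psum_def[abs_def])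

lemma ip_finite_sum:
  assumes "f \<in> L2 a b"
  shows "ip f (\<lambda>z. \<Sum>n\<in>F. d n * \<phi> n z) = (\<Sum>n\<in>F. d n * coef f n)"
  unfolding ip_commute[of f "\<lambda>z. \<Sum>n\<in>F. d n * \<phi> n z"] coef_def ip_commute[of f "\<phi> _"] using assms
  by (subst ip_sum) (auto intro!: L2_scale phi_L2 simp: ip_scale)

lemma nrm_sq_finite_sum:
  assumes "finite F"
  shows "(nrm (\<lambda>z. \<Sum>n\<in>F. d n * \<phi> n z))\<^sup>2 = (\<Sum>n\<in>F. (d n)\<^sup>2)"
  unfolding nrm_sq ip_finite_sum[OF finite_sum_L2]
  by (intro sum.cong) (simp_all add: coef_finite_sum assms power2_eq_square)

lemma coef_le_nrm: "f \<in> L2 a b \<Longrightarrow> \<bar>coef f n\<bar> \<le> nrm f"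
  using Cauchy_Schwarz[OF _ phi_L2, of f n] by (simp add: coef_def nrm_phi)

text \<open>For N > m the m-th coefficient of the partial sum is already \<open>d m\<close>, and one
  coefficient is bounded by the norm; the fixed difference therefore lies below a null
  sequence.\<close>

lemma coef_eq_of_sums_in_norm:
  assumes g: "g \<in> L2 a b" and lim: "(\<lambda>N. nrm (\<lambda>z. psum d N z - g z)) \<longlonglongrightarrow> 0"
  shows "coef g m = d m"
proof -
  have "\<bar>d m - coef g m\<bar> \<le> nrm (\<lambda>z. psum d N z - g z)" if "N > m" for N
    using coef_le_nrm[OF L2_diff[OF psum_L2 g], of d N m] that
    by (simp add: coef_diff psum_L2 g coef_psum)
  then have "\<bar>d m - coef g m\<bar> \<le> 0"
    by (intro tendsto_lowerbound[OF lim]) (auto simp: eventually_at_top_dense)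
  then show ?thesis by simp
qed

text \<open>Pythagoras: the remainder has vanishing coefficients below N, so it is orthogonal to the
  partial sum, and its norm tends to 0 by the basis property.\<close>

lemma Parseval:
  assumes f: "f \<in> L2 a b"
  shows "(\<lambda>n. (coef f n)\<^sup>2) sums (nrm f)\<^sup>2"
proof -
  have eq: "(nrm (\<lambda>z. psum (coef f) N z - f z))\<^sup>2 = (nrm f)\<^sup>2 - (\<Sum>n<N. (coef f n)\<^sup>2)" for N
  proof -
    let ?S = "psum (coef f) N"
    let ?h = "\<lambda>z. ?S z - f z"
    have h: "?h \<in> L2 a b" by (intro L2_diff psum_L2 f)
    have S: "ip g ?S = (\<Sum>n<N. coef f n * coef g n)" if "g \<in> L2 a b" for g
      using ip_finite_sum[OF that, of "coef f" "{..<N}"] by (simp add: psum_def[abs_def])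
    have "ip ?h ?h = ip ?S ?h - ip f ?h"
      by (rule ip_diff[OF psum_L2 f h])
    also have "ip f ?h = ip ?S f - ip f f"
      unfolding ip_commute[of f ?h] by (rule ip_diff[OF psum_L2 f f])
    also have "ip ?S ?h = 0"
      unfolding ip_commute[of ?S ?h] S[OF h]
      by (intro sum.neutral) (simp add: coef_diff psum_L2 f coef_psum)
    also have "ip ?S f = (\<Sum>n<N. (coef f n)\<^sup>2)"
      unfolding ip_commute[of ?S f] S[OF f] by (simp add: power2_eq_square)
    finally show ?thesis by (simp add: nrm_sq)
  qed
  have "(\<lambda>N. (nrm f)\<^sup>2 - (nrm (\<lambda>z. psum (coef f) N z - f z))\<^sup>2) \<longlonglongrightarrow> (nrm f)\<^sup>2 - 0\<^sup>2"
    by (intro tendsto_intros basis_expansion f)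
  then show ?thesis
    by (simp add: sums_def eq)
qed

text \<open>Parseval for the difference. Elements known only as limits or choices are identified in
  this way.\<close>

lemma ae_eqI_coef:
  assumes f: "f \<in> L2 a b" and g: "g \<in> L2 a b" and eq: "\<And>n. coef f n = coef g n"
  shows "ae_eq a b f g"
proof -
  have "(\<lambda>n. (coef (\<lambda>z. f z - g z) n)\<^sup>2) sums 0"
    by (simp add: coef_diff f g eq)
  then have "nrm (\<lambda>z. f z - g z) = 0"
    using Parseval[OF L2_diff[OF f g]] sums_unique2 by fastforce
  then have "AE z in M. f z - g z = 0"
    using nrm_eq_0_imp_ae_eq_0[OF L2_diff[OF f g]] by (simp add: ae_eq_def)
  then show ?thesis
    unfolding ae_eq_def by eventually_elim simp
qed

lemma nrm_abs: "nrm (\<lambda>z. \<bar>f z\<bar>) = nrm f"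
  by (simp add: norm_rho_def ip_rho_def)

lemma ennreal_nrm_sq:
  assumes "f \<in> L2 a b"
  shows "(\<integral>\<^sup>+z. ennreal ((f z)\<^sup>2 * \<rho> z) \<partial>M) = ennreal ((nrm f)\<^sup>2)"
  unfolding nrm_sq ip_rho_def power2_eq_square[of "f _"]
  using rho_pos
  by (intro nn_integral_eq_integral ip_integrable assms AE_I2) (auto simp: less_imp_le)

text \<open>Supplies the witnesses for the Hilbert choices in \<open>frac_power\<close> and
  \<open>A_frac\<close>. The limit is built pointwise almost everywhere along a rapid subsequence,
  and Fatou's lemma upgrades this to convergence in norm.\<close>

theorem Riesz_Fischer:
  assumes d: "summable (\<lambda>n. (d n)\<^sup>2)"
  obtains g where "g \<in> L2 a b" "(\<lambda>N. nrm (\<lambda>z. psum d N z - g z)) \<longlonglongrightarrow> 0"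
proof -
  define E where "E N = (\<Sum>n. (d (n + N))\<^sup>2)" for N
  have E0: "E \<longlonglongrightarrow> 0"
  proof -
    have "E = (\<lambda>N. (\<Sum>n. (d n)\<^sup>2) - (\<Sum>n<N. (d n)\<^sup>2))"
      unfolding E_def using suminf_minus_initial_segment[OF d] by auto
    moreover have "\<dots> \<longlonglongrightarrow> (\<Sum>n. (d n)\<^sup>2) - (\<Sum>n. (d n)\<^sup>2)"
      by (intro tendsto_diff tendsto_const summable_LIMSEQ d)
    ultimately show ?thesis by simp
  qed
  have Cauchy: "(nrm (\<lambda>z. psum d K z - psum d N z))\<^sup>2 \<le> E N" if "N \<le> K" for N K
  proof -
    have "(\<lambda>z. psum d K z - psum d N z) = (\<lambda>z. \<Sum>n\<in>{N..<K}. d n * \<phi> n z)"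
      using that by (simp add: psum_def sum_diff_nat_ivl flip: atLeast0LessThan)
    then have "(nrm (\<lambda>z. psum d K z - psum d N z))\<^sup>2 = (\<Sum>n\<in>{N..<K}. (d n)\<^sup>2)"
      by (simp add: nrm_sq_finite_sum)
    also have "\<dots> = (\<Sum>n<K-N. (d (n + N))\<^sup>2)"
      using that sum.shift_bounds_nat_ivl[of "\<lambda>n. (d n)\<^sup>2" 0 N "K - N"] by (simp add: atLeast0LessThan)
    also have "\<dots> \<le> E N"
      unfolding E_def by (intro sum_le_suminf summable_ignore_initial_segment d) auto
    finally show ?thesis .
  qed
  obtain r where r: "mono r" "\<And>k. k \<le> r k" "\<And>k n. r k \<le> n \<Longrightarrow> E n \<le> (1/4) ^ k"
    using eventually_small_monotone_index[OF E0] by metis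
  \<comment> \<open>Blocks between consecutive rapid indices; they telescope to
    \<open>psum d (r k)\<close>.\<close>
  define v where "v k z = psum d (r (Suc k)) z - psum d (r k) z" for k z
  have v_L2: "v k \<in> L2 a b" for k
    unfolding v_def by (intro L2_diff psum_L2)
  note [measurable] = v_L2[THEN L2_measurable] psum_L2[THEN L2_measurable]
  have v_nrm: "nrm (v k) \<le> (1/2) ^ k" for k
  proof (rule power2_le_imp_le)
    have "(nrm (v k))\<^sup>2 \<le> E (r k)"
      unfolding v_def by (intro Cauchy monoD[OF r(1)]) simp
    also have "\<dots> \<le> (1/4) ^ k"
      by (rule r(3)) simp
    also have "(1/4 :: real) ^ k = ((1/2) ^ k)\<^sup>2"
      by (simp add: power_mult_distrib power2_eq_square flip: power_mult_distrib)
    finally show "(nrm (v k))\<^sup>2 \<le> ((1/2) ^ k)\<^sup>2" .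
  qed simp
  \<comment> \<open>By Cauchy-Schwarz against the constant 1, a block's norm controls its weighted
    integral. The sum of all |v k| then has finite integral, so it is finite almost
    everywhere.\<close>
  define c where "c = nrm (\<lambda>_. 1)"
  have one_L2: "(\<lambda>_. 1) \<in> L2 a b" by (intro L2_continuous) simp
  have abs_L2: "(\<lambda>z. \<bar>v k z\<bar>) \<in> L2 a b" for k
    using v_L2[of k] by (auto simp: L2_def)
  have int_v: "(\<integral>\<^sup>+z. ennreal (\<bar>v k z\<bar> * \<rho> z) \<partial>M) \<le> ennreal ((1/2) ^ k * c)" for k
  proof -
    have "(\<integral>\<^sup>+z. ennreal (\<bar>v k z\<bar> * \<rho> z) \<partial>M) = ennreal (LINT z|M. \<bar>v k z\<bar> * 1 * \<rho> z)"
      using ip_integrable[OF abs_L2 one_L2, of k] rho_pos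
      by (subst nn_integral_eq_integral) (auto simp: less_imp_le intro!: AE_I2)
    also have "(LINT z|M. \<bar>v k z\<bar> * 1 * \<rho> z) \<le> nrm (\<lambda>z. \<bar>v k z\<bar>) * c"
      using Cauchy_Schwarz[OF abs_L2 one_L2, of k] by (simp add: ip_rho_def c_def)
    also have "\<dots> \<le> (1/2) ^ k * c"
      unfolding nrm_abs using v_nrm[of k] by (intro mult_right_mono) (simp_all add: c_def nrm_nonneg)
    finally show ?thesis
      by (simp add: ennreal_leI)
  qed
  have "(\<integral>\<^sup>+z. (\<Sum>k. ennreal (\<bar>v k z\<bar> * \<rho> z)) \<partial>M) = (\<Sum>k. \<integral>\<^sup>+z. ennreal (\<bar>v k z\<bar> * \<rho> z) \<partial>M)"
    by (intro nn_integral_suminf) simp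
  also have "\<dots> \<le> (\<Sum>k. ennreal ((1/2) ^ k * c))"
    by (intro suminf_le int_v) auto
  also have "\<dots> = ennreal (\<Sum>k. (1/2) ^ k * c)"
    by (intro suminf_ennreal2 summable_mult2 summable_geometric) (simp_all add: c_def nrm_nonneg)
  finally have "(\<integral>\<^sup>+z. (\<Sum>k. ennreal (\<bar>v k z\<bar> * \<rho> z)) \<partial>M) \<noteq> \<infinity>"
    by (auto simp: top_unique)
  then have "AE z in M. (\<Sum>k. ennreal (\<bar>v k z\<bar> * \<rho> z)) \<noteq> \<infinity>"
    by (intro nn_integral_PInf_AE) simp_all
  moreover have "AE z in M. 0 < \<rho> z"
    using rho_pos by (intro AE_I2) simp
  ultimately have conv: "AE z in M. convergent (\<lambda>k. psum d (r k) z)"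
  proof eventually_elim
    case (elim z)
    then have "summable (\<lambda>k. \<bar>v k z\<bar> * \<rho> z)"
      by (intro summable_suminf_not_top) auto
    then have "summable (\<lambda>k. \<bar>v k z\<bar> * \<rho> z * (1 / \<rho> z))"
      by (rule summable_mult2)
    moreover have "\<bar>v k z\<bar> * \<rho> z * (1 / \<rho> z) = \<bar>v k z\<bar>" for k
      using elim(2) by simp
    ultimately have "summable (\<lambda>k. \<bar>v k z\<bar>)"
      by simp
    then have "summable (\<lambda>k. v k z)"
      by (rule summable_rabs_cancel)
    then have "convergent (\<lambda>k. psum d (r 0) z + (\<Sum>i<k. v i z))"
      by (intro convergent_add convergent_const) (simp add: summable_iff_convergent)
    moreover have "psum d (r 0) z + (\<Sum>i<k. v i z) = psum d (r k) z" for k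
      by (induction k) (auto simp: v_def)
    ultimately show ?case by simp
  qed
  define g where "g z = lim (\<lambda>k. psum d (r k) z)" for z
  have g_meas [measurable]: "g \<in> borel_measurable M"
    unfolding g_def by measurable
  \<comment> \<open>Fatou runs along the subsequence with N fixed. The Cauchy estimate holds for
    every N, so the whole sequence converges and not only the subsequence.\<close>
  have fatou: "(\<integral>\<^sup>+z. ennreal ((psum d N z - g z)\<^sup>2 * \<rho> z) \<partial>M) \<le> ennreal (E N)" for N
  proof -
    let ?u = "\<lambda>k z. ennreal ((psum d (r k) z - psum d N z)\<^sup>2 * \<rho> z)"
    have "AE z in M. ennreal ((psum d N z - g z)\<^sup>2 * \<rho> z) = liminf (\<lambda>k. ?u k z)"
      using conv
    proof eventually_elim
      case (elim z)
      then have "(\<lambda>k. psum d (r k) z) \<longlonglongrightarrow> g z"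
        by (simp add: g_def convergent_LIMSEQ_iff)
      then have "(\<lambda>k. ?u k z) \<longlonglongrightarrow> ennreal ((g z - psum d N z)\<^sup>2 * \<rho> z)"
        by (intro tendsto_ennrealI tendsto_intros)
      then have "liminf (\<lambda>k. ?u k z) = ennreal ((g z - psum d N z)\<^sup>2 * \<rho> z)"
        by (intro lim_imp_Liminf) auto
      then show ?case
        by (simp add: power2_commute)
    qed
    then have "(\<integral>\<^sup>+z. ennreal ((psum d N z - g z)\<^sup>2 * \<rho> z) \<partial>M) = (\<integral>\<^sup>+z. liminf (\<lambda>k. ?u k z) \<partial>M)"
      by (rule nn_integral_cong_AE)
    also have "\<dots> \<le> liminf (\<lambda>k. \<integral>\<^sup>+z. ?u k z \<partial>M)"
      by (intro nn_integral_liminf) simp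
    also have "\<dots> \<le> limsup (\<lambda>k. \<integral>\<^sup>+z. ?u k z \<partial>M)"
      by (intro Liminf_le_Limsup) simp
    also have "\<dots> \<le> ennreal (E N)"
    proof (rule Limsup_bounded)
      show "\<forall>\<^sub>F k in sequentially. (\<integral>\<^sup>+z. ?u k z \<partial>M) \<le> ennreal (E N)"
      proof (rule eventually_sequentiallyI[of N])
        fix k assume "N \<le> k"
        then have "N \<le> r k" using r(2)[of k] by simp
        then show "(\<integral>\<^sup>+z. ?u k z \<partial>M) \<le> ennreal (E N)"
          using ennreal_nrm_sq[OF L2_diff[OF psum_L2[of d "r k"] psum_L2[of d N]]] Cauchy
          by (simp add: ennreal_leI)
      qed
    qed
    finally show ?thesis .
  qed
  have diff_L2: "(\<lambda>z. psum d N z - g z) \<in> L2 a b" for N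
  proof -
    have "integrable M (\<lambda>z. (psum d N z - g z)\<^sup>2 * \<rho> z)"
      using fatou[of N] rho_pos
      by (intro integrableI_nonneg AE_I2) (auto simp: less_imp_le intro: le_less_trans)
    then show ?thesis
      by (subst L2_iff_rho) simp_all
  qed
  have g: "g \<in> L2 a b"
    using L2_diff[OF psum_L2[of d 0] diff_L2[of 0]] by simp
  have "(nrm (\<lambda>z. psum d N z - g z))\<^sup>2 \<le> E N" for N
  proof -
    have "0 \<le> E N"
      unfolding E_def by (intro suminf_nonneg summable_ignore_initial_segment d) simp
    then show ?thesis
      using fatou[of N] unfolding ennreal_nrm_sq[OF diff_L2] by (simp add: ennreal_le_iff)
  qed
  then have "(\<lambda>N. (nrm (\<lambda>z. psum d N z - g z))\<^sup>2) \<longlonglongrightarrow> 0"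
    by (intro tendsto_sandwich[OF _ _ tendsto_const E0] always_eventually) auto
  then have "(\<lambda>N. sqrt ((nrm (\<lambda>z. psum d N z - g z))\<^sup>2)) \<longlonglongrightarrow> sqrt 0"
    by (rule tendsto_real_sqrt)
  then have "(\<lambda>N. nrm (\<lambda>z. psum d N z - g z)) \<longlonglongrightarrow> 0"
    by (simp add: nrm_nonneg)
  with g show ?thesis
    by (rule that)
qed

end

section \<open>Regularity of eigenfunctions and the energy identity\<close>

text \<open>
  The difference \<open>F\<close> of the two sides satisfies \<open>\<bar>F y - F x\<bar> \<le> 2 K \<bar>y - x\<bar> \<bar>H y - H x\<bar>\<close> with
  \<open>H\<close> the indefinite integral of \<open>\<bar>g\<bar>\<close>, so its derivative vanishes everywhere.
\<close>
lemma product_rule_indefinite_integral: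
  fixes a b :: real and P P' u g :: "real \<Rightarrow> real"
  assumes P: "\<And>x. x \<in> {a..b} \<Longrightarrow> (P has_real_derivative P' x) (at x within {a..b})"
    and P': "continuous_on {a..b} P'"
    and g: "g absolutely_integrable_on {a..b}"
    and u: "\<And>x. x \<in> {a..b} \<Longrightarrow> u x = u a + integral {a..x} g"
    and x: "x \<in> {a..b}"
  shows "P x * u x = P a * u a + integral {a..x} (\<lambda>s. P' s * u s + P s * g s)"
proof -
  let ?f = "\<lambda>s. P' s * u s + P s * g s"
  have contP: "continuous_on {a..b} P"
    using P by (intro DERIV_continuous_on)
  have g1: "g integrable_on {a..b}" and g2: "(\<lambda>s. \<bar>g s\<bar>) integrable_on {a..b}"
    using g by (auto simp: absolutely_integrable_on_def)
  have contu: "continuous_on {a..b} u"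
  proof (rule continuous_on_eq)
    show "continuous_on {a..b} (\<lambda>x. u a + integral {a..x} g)"
      by (intro continuous_intros indefinite_integral_continuous_1 g1)
  qed (rule u[symmetric])
  have f: "?f integrable_on {a..b}"
  proof (rule integrable_add)
    show "(\<lambda>s. P' s * u s) integrable_on {a..b}"
      by (intro integrable_continuous_real continuous_intros P' contu)
    have "(\<lambda>s. P s * g s) absolutely_integrable_on {a..b}"
      using contP g
      by (intro absolutely_integrable_bounded_measurable_product_real
          continuous_imp_measurable_on_sets_lebesgue compact_imp_bounded compact_continuous_image) auto
    then show "(\<lambda>s. P s * g s) integrable_on {a..b}"
      by (rule set_lebesgue_integral_eq_integral)
  qed
  have "bounded (P' ` {a..b})"
    by (intro compact_imp_bounded compact_continuous_image P') simp
  then obtain K where "0 < K" "\<forall>x \<in> P' ` {a..b}. norm x \<le> K"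
    unfolding bounded_pos by blast
  then have K: "0 \<le> K" "\<And>s. s \<in> {a..b} \<Longrightarrow> \<bar>P' s\<bar> \<le> K"
    by auto
  have Lip: "\<bar>P y - P s\<bar> \<le> K * \<bar>y - s\<bar>" if "y \<in> {a..b}" "s \<in> {a..b}" for y s
    using field_differentiable_bound[of "{a..b}" P P' K s y] P K that by (auto simp: abs_minus_commute)
  define H where "H z = integral {a..z} (\<lambda>s. \<bar>g s\<bar>)" for z
  define F where "F z = P z * u z - integral {a..z} ?f" for z
  have incr: "integral {a..t} h - integral {a..s} h = integral {s..t} h"
    if "h integrable_on {a..b}" "s \<le> t" "s \<in> {a..b}" "t \<in> {a..b}" for h :: "real \<Rightarrow> real" and s t
  proof -
    have "h integrable_on {a..t}"
      using that by (intro integrable_on_subinterval[OF that(1)]) auto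
    then have "integral {a..s} h + integral {s..t} h = integral {a..t} h"
      using that by (intro Henstock_Kurzweil_Integration.integral_combine) auto
    then show ?thesis by simp
  qed
  have incru: "integral {s..t} g = u t - u s" if "s \<le> t" "s \<in> {a..b}" "t \<in> {a..b}" for s t
    using incr[OF g1 that] u[OF that(2)] u[OF that(3)] by linarith
  have step: "\<bar>F t - F s\<bar> \<le> 2 * K * (t - s) * (H t - H s)"
    if st: "s \<le> t" "s \<in> {a..b}" "t \<in> {a..b}" for s t
  proof -
    have sub: "{s..t} \<subseteq> {a..b}" using st by auto
    have i: "h integrable_on {s..t}" if "h integrable_on {a..b}" for h :: "real \<Rightarrow> real"
      using integrable_on_subinterval[OF that sub] .
    have I1: "((\<lambda>r. P t * g r) has_integral P t * (u t - u s)) {s..t}"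
      using incru[OF st] i[OF g1] by (intro has_integral_mult_right) (simp add: has_integral_iff)
    have "(P' has_integral (P t - P s)) {s..t}"
      using st(1) by (rule fundamental_theorem_of_calculus)
        (use sub in \<open>auto intro!: DERIV_subset[OF P] simp: has_real_derivative_iff_has_vector_derivative[symmetric]\<close>)
    then have I2: "((\<lambda>r. P' r * u s) has_integral (P t - P s) * u s) {s..t}"
      by (rule has_integral_mult_left)
    have I3: "(?f has_integral (integral {a..t} ?f - integral {a..s} ?f)) {s..t}"
      unfolding incr[OF f st] using i[OF f] by (rule integrable_integral)
    \<comment> \<open>Freezing P at t and u at s leaves the integrand (P t - P r) g r + P' r (u s -
      u r). Each term has one small factor, and integration over [s,t] supplies the second; the two
      contributions give the factor 2 in 2 K.\<close>
    have "((\<lambda>r. P t * g r + P' r * u s - ?f r) has_integral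
        (P t * (u t - u s) + (P t - P s) * u s - (integral {a..t} ?f - integral {a..s} ?f))) {s..t}"
      by (intro has_integral_diff has_integral_add I1 I2 I3)
    moreover have "P t * (u t - u s) + (P t - P s) * u s - (integral {a..t} ?f - integral {a..s} ?f) = F t - F s"
      by (simp add: F_def algebra_simps)
    ultimately have *: "((\<lambda>r. P t * g r + P' r * u s - ?f r) has_integral (F t - F s)) {s..t}"
      by simp
    have "((\<lambda>r. \<bar>g r\<bar>) has_integral (H t - H s)) {s..t}"
      unfolding H_def incr[OF g2 st] using i[OF g2] by (rule integrable_integral)
    then have **: "((\<lambda>r. K * (t - s) * \<bar>g r\<bar> + K * (H t - H s)) has_integral
        (K * (t - s) * (H t - H s) + (t - s) * (K * (H t - H s)))) {s..t}"
      using has_integral_const_real[of "K * (H t - H s)" s t] st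
      by (intro has_integral_add has_integral_mult_right) auto
    have "norm (integral {s..t} (\<lambda>r. P t * g r + P' r * u s - ?f r))
        \<le> integral {s..t} (\<lambda>r. K * (t - s) * \<bar>g r\<bar> + K * (H t - H s))"
    proof (rule Henstock_Kurzweil_Integration.integral_norm_bound_integral)
      fix r assume "r \<in> {s..t}"
      then have r: "s \<le> r \<and> r \<le> t" by simp
      have rab: "r \<in> {a..b}" using r st by auto
      have "\<bar>P t - P r\<bar> \<le> K * (t - s)"
        using Lip[OF st(3) rab] r K(1) by (smt (verit) mult_left_mono)
      then have "\<bar>P t - P r\<bar> * \<bar>g r\<bar> \<le> K * (t - s) * \<bar>g r\<bar>"
        by (intro mult_right_mono) auto
      moreover have "\<bar>u s - u r\<bar> \<le> H t - H s"
      proof -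
        have "u s - u r = - integral {s..r} g"
          using incru[of s r] st r rab by simp
        also have "\<bar>\<dots>\<bar> \<le> integral {s..r} (\<lambda>s. \<bar>g s\<bar>)"
          using Henstock_Kurzweil_Integration.integral_norm_bound_integral[of g "{s..r}" "\<lambda>s. \<bar>g s\<bar>"]
            integrable_on_subinterval[OF g1, of s r] integrable_on_subinterval[OF g2, of s r] sub r
          by simp
        also have "\<dots> \<le> integral {s..t} (\<lambda>s. \<bar>g s\<bar>)"
          using sub r by (intro integral_subset_le) (auto intro!: integrable_on_subinterval[OF g2])
        also have "\<dots> = H t - H s"
          unfolding H_def incr[OF g2 st] ..
        finally show ?thesis .
      qed
      then have "\<bar>P' r\<bar> * \<bar>u s - u r\<bar> \<le> K * (H t - H s)"
        using K rab by (intro mult_mono) auto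
      moreover have "P t * g r + P' r * u s - ?f r = (P t - P r) * g r + P' r * (u s - u r)"
        by (simp add: algebra_simps)
      ultimately show "norm (P t * g r + P' r * u s - ?f r) \<le> K * (t - s) * \<bar>g r\<bar> + K * (H t - H s)"
        using abs_triangle_ineq[of "(P t - P r) * g r" "P' r * (u s - u r)"] by (simp add: abs_mult)
    qed (use * ** in blast)+
    then show ?thesis
      unfolding integral_unique[OF * ] integral_unique[OF ** ] by (simp add: algebra_simps)
  qed
  have contH: "continuous_on {a..b} H"
    unfolding H_def by (intro indefinite_integral_continuous_1 g2)
  \<comment> \<open>After division by t - s there remains 2 K |H t - H s|, which tends to 0 by mere
    continuity of \<open>H\<close>.\<close>
  have "(F has_real_derivative 0) (at s within {a..b})" if s: "s \<in> {a..b}" for s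
    unfolding has_field_derivative_iff
  proof (rule tendsto_rabs_zero_cancel, rule tendsto_sandwich[OF _ _ tendsto_const])
    have "((\<lambda>t. H t) \<longlongrightarrow> H s) (at s within {a..b})"
      using contH s by (simp add: continuous_on)
    then have "((\<lambda>t. 2 * K * \<bar>H t - H s\<bar>) \<longlongrightarrow> 2 * K * \<bar>H s - H s\<bar>) (at s within {a..b})"
      by (intro tendsto_intros)
    then show "((\<lambda>t. 2 * K * \<bar>H t - H s\<bar>) \<longlongrightarrow> 0) (at s within {a..b})" by simp
    have "\<bar>(F t - F s) / (t - s)\<bar> \<le> 2 * K * \<bar>H t - H s\<bar>" if t: "t \<in> {a..b}" "t \<noteq> s" for t
    proof -
      have "\<bar>F t - F s\<bar> \<le> 2 * K * \<bar>H t - H s\<bar> * \<bar>t - s\<bar>"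
      proof (cases "s \<le> t")
        case True
        have "2 * K * (t - s) * (H t - H s) \<le> 2 * K * (t - s) * \<bar>H t - H s\<bar>"
          using True K by (intro mult_left_mono) auto
        with step[OF True s t(1)] have "\<bar>F t - F s\<bar> \<le> 2 * K * (t - s) * \<bar>H t - H s\<bar>"
          by (rule order_trans)
        moreover have "\<bar>t - s\<bar> = t - s" using True by simp
        ultimately show ?thesis by (simp only: mult_ac)
      next
        case False
        have "2 * K * (s - t) * (H s - H t) \<le> 2 * K * (s - t) * \<bar>H s - H t\<bar>"
          using False K by (intro mult_left_mono) auto
        with step[OF _ t(1) s] False have "\<bar>F s - F t\<bar> \<le> 2 * K * (s - t) * \<bar>H s - H t\<bar>"
          by (intro order_trans[OF step]) (use s t in auto)
        moreover have "\<bar>t - s\<bar> = s - t" using False by simp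
        ultimately show ?thesis
          unfolding abs_minus_commute[of "F t" "F s"] abs_minus_commute[of "H t" "H s"]
          by (simp only: mult_ac)
      qed
      then show ?thesis
        using t by (simp add: pos_divide_le_eq)
    qed
    then show "\<forall>\<^sub>F t in at s within {a..b}. \<bar>(F t - F s) / (t - s)\<bar> \<le> 2 * K * \<bar>H t - H s\<bar>"
      by (auto simp: eventually_at_filter)
  qed simp
  then obtain c where "\<And>s. s \<in> {a..b} \<Longrightarrow> F s = c"
    using has_field_derivative_zero_constant[of "{a..b}" F] by auto
  then have "F x = F a" using x by auto
  then show ?thesis by (simp add: F_def)
qed

lemma AE_lebesgue_on_subset:
  assumes "AE z in lebesgue_on {a..b::real}. Q z" "{c..d} \<subseteq> {a..b}"
  shows "AE z in lebesgue_on {c..d}. Q z"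
  using assms by (auto simp: AE_restrict_space_iff)

lemma (in weighted_L2) L2_integrable: "f \<in> L2 a b \<Longrightarrow> integrable M f"
  using L2_mult_integrable[OF _ L2_continuous[of "\<lambda>_. 1"], of f] by simp

lemma (in weighted_L2) L2_mult_continuous:
  assumes h: "continuous_on {a..b} h" and f: "f \<in> L2 a b"
  shows "(\<lambda>z. h z * f z) \<in> L2 a b"
proof -
  note [measurable] = L2_measurable[OF f] measurable_cont[OF h]
  have "integrable M (\<lambda>z. (h z)\<^sup>2 * (f z)\<^sup>2)"
  proof -
    have "(\<lambda>z. (h z)\<^sup>2 * (f z)\<^sup>2) absolutely_integrable_on {a..b}"
    proof (rule absolutely_integrable_bounded_measurable_product_real)
      show "bounded ((\<lambda>z. (h z)\<^sup>2) ` {a..b})"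
        by (intro compact_imp_bounded compact_continuous_image continuous_intros h) simp
      show "(\<lambda>z. (f z)\<^sup>2) absolutely_integrable_on {a..b}"
        using f by (simp add: L2_def set_integrable_def integrable_restrict_space)
    qed auto
    then show ?thesis
      by (intro absolutely_integrable_imp_integrable) auto
  qed
  then show ?thesis
    by (simp add: L2_def power_mult_distrib)
qed

section \<open>From the weak equation to classical derivatives\<close>

locale sturm_liouville =
  fixes a b :: real and p q \<rho> :: "real \<Rightarrow> real"
  assumes coeffs: "SL_coefficients a b p q \<rho>"
begin

sublocale weighted_L2 a b \<rho>
  using coeffs by unfold_locales (auto simp: SL_coefficients_def)

lemma cont_p: "continuous_on {a..b} p" and cont_q: "continuous_on {a..b} q"
  and p_pos: "z \<in> {a..b} \<Longrightarrow> 0 < p z"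
  and cont_p': "continuous_on {a..b} (deriv_on a b p)"
  and deriv_p: "z \<in> {a..b} \<Longrightarrow> (p has_real_derivative deriv_on a b p z) (at z within {a..b})"
  using coeffs by (auto simp: SL_coefficients_def deriv_on_def vector_derivative_works
      has_real_derivative_iff_has_vector_derivative)

lemma ip_continuous:
  assumes "continuous_on {a..b} f" "continuous_on {a..b} g"
  shows "ip f g = integral {a..b} (\<lambda>z. f z * g z * \<rho> z)"
  unfolding ip_rho_def
  by (intro lebesgue_integral_eq_integral continuous_imp_integrable_real continuous_intros assms cont_rho) simp

text \<open>\<open>SL_op\<close> applies \<open>L2_deriv\<close>, a Hilbert choice that carries
  information only if some weak derivative exists. The domain provides one, g, for f'; the product
  rule with the C^1 factor p carries it over to the flux, with derivative -(p' f' + p g).\<close>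

lemma H2_flux_has_L2_deriv:
  assumes f: "f \<in> H2 a b"
  shows "has_L2_deriv a b (\<lambda>y. - p y * deriv_on a b f y) (L2_deriv a b (\<lambda>y. - p y * deriv_on a b f y))"
proof -
  let ?f' = "deriv_on a b f"
  obtain g where g: "g \<in> L2 a b"
    and g_eq: "\<And>x. x \<in> {a..b} \<Longrightarrow> ?f' x = ?f' a + (LINT z|lebesgue_on {a..x}. g z)"
    using f unfolding H2_def H1_def has_L2_deriv_def by blast
  have g_abs: "g absolutely_integrable_on {a..b}"
    using L2_integrable[OF g] by (simp add: set_integrable_def integrable_restrict_space)
  have LINT: "(LINT z|lebesgue_on {a..x}. h z) = integral {a..x} h" if "x \<in> {a..b}" "integrable M h" for x and h :: "real \<Rightarrow> real"
    using that(1) by (intro lebesgue_integral_eq_integral integrable_subinterval[OF that(2)]) auto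
  have u: "?f' x = ?f' a + integral {a..x} g" if "x \<in> {a..b}" for x
    using g_eq[OF that] LINT[OF that L2_integrable[OF g]] by simp
  have cont_f': "continuous_on {a..b} ?f'"
  proof (rule continuous_on_eq)
    show "continuous_on {a..b} (\<lambda>x. ?f' a + integral {a..x} g)"
      using g_abs by (intro continuous_intros indefinite_integral_continuous_1) (simp add: absolutely_integrable_on_def)
  qed (rule u[symmetric])
  let ?G = "\<lambda>z. deriv_on a b p z * ?f' z + p z * g z"
  have G: "?G \<in> L2 a b"
    by (intro L2_add L2_mult_continuous cont_p cont_p' g L2_continuous continuous_intros cont_f')
  have "has_L2_deriv a b (\<lambda>y. - p y * ?f' y) (\<lambda>z. - ?G z)"
    unfolding has_L2_deriv_def
  proof (intro conjI ballI)
    show "(\<lambda>z. - ?G z) \<in> L2 a b"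
      using L2_scale[OF G, of "-1"] by simp
    fix x assume x: "x \<in> {a..b}"
    have "p x * ?f' x = p a * ?f' a + integral {a..x} ?G"
      by (rule product_rule_indefinite_integral[OF deriv_p cont_p' g_abs u x])
    also have "integral {a..x} ?G = (LINT z|lebesgue_on {a..x}. ?G z)"
      by (rule LINT[OF x L2_integrable[OF G], symmetric])
    finally show "- p x * ?f' x = - p a * ?f' a + (LINT z|lebesgue_on {a..x}. - ?G z)"
      unfolding Bochner_Integration.integral_minus by simp
  qed
  then have "\<exists>G. has_L2_deriv a b (\<lambda>y. - p y * ?f' y) G"
    by blast
  then show ?thesis
    unfolding L2_deriv_def by (rule someI_ex)
qed

text \<open>Bootstrapping: almost everywhere the flux derivative equals a function that is
  continuous because f is. The flux is thus an indefinite integral of a continuous function and is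
  differentiable everywhere, one-sidedly at the end points.\<close>

lemma eigenfunction_C2:
  assumes ef: "eigenfunction_A a b p q \<rho> \<alpha>a \<beta>a \<alpha>b \<beta>b l f" and z: "z \<in> {a..b}"
  shows "(f has_real_derivative deriv_on a b f z) (at z within {a..b})"
    and "((\<lambda>z. p z * deriv_on a b f z) has_real_derivative (l * \<rho> z + q z) * f z) (at z within {a..b})"
proof -
  let ?w = "\<lambda>y. - p y * deriv_on a b f y"
  let ?h = "\<lambda>z. - ((l * \<rho> z + q z) * f z)"
  have H2: "f \<in> H2 a b" and ae: "AE z in M. - SL_op a b p q \<rho> f z = l * f z"
    using ef by (auto simp: eigenfunction_A_def SL_dom_def ae_eq_def)
  have deriv_f: "(f has_real_derivative deriv_on a b f z) (at z within {a..b})" if "z \<in> {a..b}" for z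
    using H2 that by (auto simp: H2_def deriv_on_def vector_derivative_works
      has_real_derivative_iff_has_vector_derivative)
  show "(f has_real_derivative deriv_on a b f z) (at z within {a..b})"
    by (rule deriv_f[OF z])
  have "continuous_on {a..b} f"
    using deriv_f by (intro DERIV_continuous_on)
  then have cont_h: "continuous_on {a..b} ?h"
    by (intro continuous_intros cont_rho cont_q)
  define G where "G = L2_deriv a b ?w"
  have G: "has_L2_deriv a b ?w G"
    unfolding G_def by (rule H2_flux_has_L2_deriv[OF H2])
  then have G_L2: "G \<in> L2 a b" and w_G: "?w x = ?w a + (LINT z|lebesgue_on {a..x}. G z)"
    if "x \<in> {a..b}" for x
    using that unfolding has_L2_deriv_def by blast+
  have "AE z in M. 0 < \<rho> z"
    using rho_pos by (intro AE_I2) simp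
  with ae have G_h: "AE z in M. G z = ?h z"
  proof eventually_elim
    case (elim z)
    then have "- (G z + q z * f z) = l * f z * \<rho> z"
      by (simp add: SL_op_def G_def field_simps)
    then show ?case by (simp add: algebra_simps)
  qed
  have w: "?w x = ?w a + integral {a..x} ?h" if x: "x \<in> {a..b}" for x
  proof -
    have sub: "{a..x} \<subseteq> {a..b}" using x by auto
    have int_h: "integrable (lebesgue_on {a..x}) ?h"
      using cont_h sub by (intro continuous_imp_integrable_real) (rule continuous_on_subset)
    have "integrable (lebesgue_on {a..x}) G"
      by (rule integrable_subinterval[OF L2_integrable[OF G_L2[OF z]] sub])
    then have "(LINT z|lebesgue_on {a..x}. G z) = (LINT z|lebesgue_on {a..x}. ?h z)"
      using int_h by (intro integral_cong_AE AE_lebesgue_on_subset[OF G_h sub]) auto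
    also have "\<dots> = integral {a..x} ?h"
      using int_h by (intro lebesgue_integral_eq_integral) auto
    finally show ?thesis
      using w_G[OF x] by simp
  qed
  have "((\<lambda>x. p a * deriv_on a b f a - integral {a..x} ?h) has_real_derivative 0 - ?h z) (at z within {a..b})"
    by (intro DERIV_diff DERIV_const integral_has_real_derivative cont_h z)
  then show "((\<lambda>z. p z * deriv_on a b f z) has_real_derivative (l * \<rho> z + q z) * f z) (at z within {a..b})"
  proof (rule has_field_derivative_transform_within[OF _ zero_less_one z, THEN DERIV_cong])
    fix x assume "x \<in> {a..b}"
    from w[OF this] show "p a * deriv_on a b f a - integral {a..x} ?h = p x * deriv_on a b f x"
      by simp
  qed simp
qed

text \<open>Integrates (p f' f)' = k f + p f'^2 over [a,b]. The function \<open>k\<close> is kept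
  general because a combination of eigenfunctions does not satisfy an eigenvalue equation
  itself.\<close>

lemma energy_identity:
  assumes f: "\<And>z. z \<in> {a..b} \<Longrightarrow> (f has_real_derivative f' z) (at z within {a..b})"
    and pf': "\<And>z. z \<in> {a..b} \<Longrightarrow> ((\<lambda>z. p z * f' z) has_real_derivative k z) (at z within {a..b})"
    and k: "continuous_on {a..b} k"
  shows "continuous_on {a..b} f'"
    and "integral {a..b} (\<lambda>z. p z * (f' z)\<^sup>2) = p b * f' b * f b - p a * f' a * f a - integral {a..b} (\<lambda>z. k z * f z)"
proof -
  have cf: "continuous_on {a..b} f"
    using f by (intro DERIV_continuous_on)
  have "continuous_on {a..b} (\<lambda>z. p z * f' z)"
    using pf' by (intro DERIV_continuous_on)
  then have "continuous_on {a..b} (\<lambda>z. p z * f' z / p z)"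
    using p_pos by (intro continuous_on_divide cont_p) force+
  then show cf': "continuous_on {a..b} f'"
    by (rule continuous_on_eq) (use p_pos in force)
  have "((\<lambda>z. k z * f z + p z * (f' z)\<^sup>2) has_integral (p b * f' b * f b - p a * f' a * f a)) {a..b}"
  proof (rule fundamental_theorem_of_calculus)
    show "a \<le> b" using ab by simp
    fix z assume z: "z \<in> {a..b}"
    show "((\<lambda>z. p z * f' z * f z) has_vector_derivative (k z * f z + p z * (f' z)\<^sup>2)) (at z within {a..b})"
      unfolding has_real_derivative_iff_has_vector_derivative[symmetric]
      by (rule DERIV_cong[OF DERIV_mult[OF pf'[OF z] f[OF z]]]) (simp add: power2_eq_square algebra_simps)
  qed
  moreover have "integral {a..b} (\<lambda>z. k z * f z + p z * (f' z)\<^sup>2)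
      = integral {a..b} (\<lambda>z. k z * f z) + integral {a..b} (\<lambda>z. p z * (f' z)\<^sup>2)"
    by (intro Henstock_Kurzweil_Integration.integral_add integrable_continuous_real continuous_intros k cf cf' cont_p)
  ultimately show "integral {a..b} (\<lambda>z. p z * (f' z)\<^sup>2) = p b * f' b * f b - p a * f' a * f a - integral {a..b} (\<lambda>z. k z * f z)"
    by (simp add: integral_unique)
qed

end

text \<open>Since |(f^2)'| = |2 f f'| \<le> f^2 + f'^2, the function f^2 oscillates by at most the
  squared H^1 norm. Integrating the resulting bound of f(z)^2 by f(y)^2 plus that norm over y
  produces the factor b - a.\<close>

lemma sup_le_H1_norm:
  fixes a b :: real and f f' :: "real \<Rightarrow> real"
  assumes ab: "a < b"
    and f: "\<And>z. z \<in> {a..b} \<Longrightarrow> (f has_real_derivative f' z) (at z within {a..b})"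
    and f': "continuous_on {a..b} f'" and z: "z \<in> {a..b}"
  shows "(b - a) * (f z)\<^sup>2 \<le> (1 + (b - a)) * integral {a..b} (\<lambda>y. (f y)\<^sup>2) + (b - a) * integral {a..b} (\<lambda>y. (f' y)\<^sup>2)"
proof -
  have cf: "continuous_on {a..b} f"
    using f by (intro DERIV_continuous_on)
  let ?I = "integral {a..b} (\<lambda>y. (f y)\<^sup>2 + (f' y)\<^sup>2)"
  have step: "\<bar>(f t)\<^sup>2 - (f s)\<^sup>2\<bar> \<le> ?I" if st: "s \<le> t" "s \<in> {a..b}" "t \<in> {a..b}" for s t
  proof -
    have sub: "{s..t} \<subseteq> {a..b}" using st by auto
    have i: "(\<lambda>y. (f y)\<^sup>2 + (f' y)\<^sup>2) integrable_on {s..t}"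
      using sub by (intro integrable_continuous_real continuous_intros continuous_on_subset[OF cf] continuous_on_subset[OF f'])
    have "((\<lambda>y. 2 * f y * f' y) has_integral ((f t)\<^sup>2 - (f s)\<^sup>2)) {s..t}"
    proof (rule fundamental_theorem_of_calculus[OF st(1)])
      fix y assume "y \<in> {s..t}"
      then have "(f has_real_derivative f' y) (at y within {s..t})"
        using f sub DERIV_subset by blast
      then show "((\<lambda>y. (f y)\<^sup>2) has_vector_derivative 2 * f y * f' y) (at y within {s..t})"
        unfolding has_real_derivative_iff_has_vector_derivative[symmetric]
        by (auto intro!: derivative_eq_intros)
    qed
    moreover have "norm (integral {s..t} (\<lambda>y. 2 * f y * f' y)) \<le> integral {s..t} (\<lambda>y. (f y)\<^sup>2 + (f' y)\<^sup>2)"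
    proof (rule Henstock_Kurzweil_Integration.integral_norm_bound_integral[OF _ i])
      show "(\<lambda>y. 2 * f y * f' y) integrable_on {s..t}"
        using calculation by blast
      show "norm (2 * f y * f' y) \<le> (f y)\<^sup>2 + (f' y)\<^sup>2" for y
        using sum_squares_bound[of "\<bar>f y\<bar>" "\<bar>f' y\<bar>"] by (simp add: abs_mult)
    qed
    moreover have "integral {s..t} (\<lambda>y. (f y)\<^sup>2 + (f' y)\<^sup>2) \<le> ?I"
      using sub by (intro integral_subset_le i integrable_continuous_real continuous_intros cf f') auto
    ultimately show ?thesis
      by (simp add: integral_unique)
  qed
  have le: "(f z)\<^sup>2 \<le> (f y)\<^sup>2 + ?I" if "y \<in> {a..b}" for y
    using step[of y z] step[of z y] that z by (cases "y \<le> z") auto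
  have "integral {a..b} (\<lambda>y. (f z)\<^sup>2) \<le> integral {a..b} (\<lambda>y. (f y)\<^sup>2 + ?I)"
    by (intro integral_le integrable_continuous_real continuous_intros cf le)
  also have "\<dots> = integral {a..b} (\<lambda>y. (f y)\<^sup>2) + (b - a) * ?I"
    using ab by (subst Henstock_Kurzweil_Integration.integral_add)
      (auto intro!: integrable_continuous_real continuous_intros cf)
  also have "?I = integral {a..b} (\<lambda>y. (f y)\<^sup>2) + integral {a..b} (\<lambda>y. (f' y)\<^sup>2)"
    by (intro Henstock_Kurzweil_Integration.integral_add integrable_continuous_real continuous_intros cf f')
  finally show ?thesis
    using ab by (simp add: algebra_simps)
qed

section \<open>Point evaluation on the form domain\<close>

text \<open>The continuous function |f - g| has integral 0, so it vanishes on all of [a,b]. This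
  makes the definite description in \<open>point_obs\<close> well defined, also when \<eta> is an
  end point.\<close>

lemma continuous_ae_eq_imp_eq:
  assumes "a < b" and f: "continuous_on {a..b} f" and g: "continuous_on {a..b} g"
    and ae: "ae_eq a b f g" and z: "z \<in> {a..b}"
  shows "f z = g z"
proof -
  have "AE z in lebesgue_on {a..b}. \<bar>f z - g z\<bar> = 0"
    using ae unfolding ae_eq_def by eventually_elim simp
  then have "(LINT z|lebesgue_on {a..b}. \<bar>f z - g z\<bar>) = 0"
    by (rule integral_eq_zero_AE)
  moreover have "continuous_on {a..b} (\<lambda>z. \<bar>f z - g z\<bar>)"
    by (intro continuous_intros f g)
  ultimately have "\<bar>f z - g z\<bar> = 0"
    using integralL_eq_0_iff[of a b "\<lambda>z. \<bar>f z - g z\<bar>"] \<open>a < b\<close> z by simp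
  then show ?thesis by simp
qed

lemma point_obs_eqI:
  assumes "a < b" "continuous_on {a..b} g" "ae_eq a b x g" "\<eta> \<in> {a..b}"
  shows "point_obs a b \<eta> x = g \<eta>"
  unfolding point_obs_def
proof (rule the_equality)
  show "\<exists>h. continuous_on {a..b} h \<and> ae_eq a b x h \<and> g \<eta> = h \<eta>"
    using assms by blast
  fix v assume "\<exists>h. continuous_on {a..b} h \<and> ae_eq a b x h \<and> v = h \<eta>"
  then obtain h where h: "continuous_on {a..b} h" "ae_eq a b x h" "v = h \<eta>" by blast
  have "ae_eq a b h g"
    using h(2) assms(3) unfolding ae_eq_def by eventually_elim simp
  then show "v = g \<eta>"
    using continuous_ae_eq_imp_eq[OF assms(1) h(1) assms(2) _ assms(4)] h(3) by simp
qed

text \<open>The evaluation estimates live in the form domain, exponent 1/2; hence the locale records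
  the gap \<epsilon> and the boundary conditions but no exponent.\<close>

locale sturm_liouville_system = sturm_liouville a b p q \<rho> for a b p q \<rho> +
  fixes \<alpha>a \<beta>a \<alpha>b \<beta>b \<mu> \<epsilon> :: real and lam :: "nat \<Rightarrow> real" and \<phi> :: "nat \<Rightarrow> real \<Rightarrow> real"
  assumes nondeg: "(\<alpha>a, \<beta>a) \<noteq> (0, 0)" "(\<alpha>b, \<beta>b) \<noteq> (0, 0)"
    and bc: "Dirichlet_bc \<alpha>a \<beta>a \<alpha>b \<beta>b \<or> Neumann_bc \<alpha>a \<beta>a \<alpha>b \<beta>b \<or> mixed_bc \<alpha>a \<beta>a \<alpha>b \<beta>b"
    and eigensystem: "eigensystem_A a b p q \<rho> \<alpha>a \<beta>a \<alpha>b \<beta>b lam \<phi>"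
    and onb: "orthonormal_basis_rho a b \<rho> \<phi>"
    and eps_pos: "0 < \<epsilon>" and gap: "\<epsilon> \<le> \<mu> - lam n"
begin

sublocale weighted_L2_basis a b \<rho> \<phi>
  by unfold_locales (rule onb)

lemma gap_pos: "0 < \<mu> - lam n"
  using gap[of n] eps_pos by simp

lemma phi_eigenfunction: "eigenfunction_A a b p q \<rho> \<alpha>a \<beta>a \<alpha>b \<beta>b (lam n) (\<phi> n)"
  using eigensystem by (simp add: eigensystem_A_def)

lemmas deriv_phi = eigenfunction_C2(1)[OF phi_eigenfunction]
  and deriv_flux_phi = eigenfunction_C2(2)[OF phi_eigenfunction]

lemma cont_phi: "continuous_on {a..b} (\<phi> n)"
  using deriv_phi by (intro DERIV_continuous_on)

text \<open>Nondegeneracy makes one factor of each product vanish for Dirichlet and Neumann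
  conditions; for mixed ones the derivative is -(\<beta>/\<alpha>) times the value. Stating this for
  bare numbers allows its use for linear combinations.\<close>

lemma boundary_signs:
  assumes "\<alpha>a * da + \<beta>a * fa = 0" "\<alpha>b * db + \<beta>b * fb = 0"
  shows "db * fb \<le> 0" "0 \<le> da * fa"
proof -
  have zero: "da * fa = 0 \<and> db * fb = 0" if "Dirichlet_bc \<alpha>a \<beta>a \<alpha>b \<beta>b \<or> Neumann_bc \<alpha>a \<beta>a \<alpha>b \<beta>b"
    using that assms nondeg by (auto simp: Dirichlet_bc_def Neumann_bc_def)
  have mixed: "db * fb \<le> 0 \<and> 0 \<le> da * fa" if "mixed_bc \<alpha>a \<beta>a \<alpha>b \<beta>b"
  proof -
    have nz: "\<alpha>a \<noteq> 0" "\<alpha>b \<noteq> 0" "\<beta>a / \<alpha>a < 0" "\<beta>b / \<alpha>b > 0"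
      using that by (auto simp: mixed_bc_def)
    have "da = - (\<beta>a / \<alpha>a) * fa" "db = - (\<beta>b / \<alpha>b) * fb"
      using assms nz(1,2) by (auto simp: field_simps)
    then have "da * fa = - (\<beta>a / \<alpha>a) * (fa * fa)" "db * fb = - ((\<beta>b / \<alpha>b) * (fb * fb))"
      by simp_all
    moreover have "0 \<le> - (\<beta>a / \<alpha>a) * (fa * fa)"
      using nz(3) by (intro mult_nonneg_nonneg[OF _ zero_le_square]) simp
    moreover have "0 \<le> (\<beta>b / \<alpha>b) * (fb * fb)"
      using nz(4) by (intro mult_nonneg_nonneg[OF _ zero_le_square]) simp
    ultimately show ?thesis by simp
  qed
  show "db * fb \<le> 0" "0 \<le> da * fa"
    using zero mixed bc by auto
qed

text \<open>
  The energy identity bounds the \<open>H\<^sup>1\<close> norm of a finite combination of eigenfunctions by its norm in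
  the form domain; the boundary terms have the right sign for the three types of conditions, and
  negative contributions of the potential are absorbed by the gap \<open>\<epsilon>\<close>.
\<close>
lemma pointwise_bound:
  "\<exists>C\<ge>0. \<forall>F. finite F \<longrightarrow> (\<forall>c. \<forall>z\<in>{a..b}.
      (\<Sum>n\<in>F. c n * \<phi> n z)\<^sup>2 \<le> C * (\<Sum>n\<in>F. (\<mu> - lam n) * (c n)\<^sup>2))"
proof -
  have ne: "{a..b} \<noteq> {}" using ab by auto
  obtain r where r: "0 < r" "\<And>z. z \<in> {a..b} \<Longrightarrow> r \<le> \<rho> z"
    using rho_bounds by metis
  obtain z0 where "z0 \<in> {a..b}" "\<forall>z\<in>{a..b}. p z0 \<le> p z"
    using continuous_attains_inf[OF compact_Icc ne cont_p] by auto
  with p_pos obtain p0 where p0: "0 < p0" "\<And>z. z \<in> {a..b} \<Longrightarrow> p0 \<le> p z"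
    by blast
  obtain Q where Q: "0 \<le> Q" "\<And>z. z \<in> {a..b} \<Longrightarrow> - q z \<le> Q"
  proof -
    have "bounded (q ` {a..b})"
      by (intro compact_imp_bounded compact_continuous_image cont_q) simp
    then obtain K where "0 < K" "\<forall>x \<in> q ` {a..b}. norm x \<le> K"
      unfolding bounded_pos by blast
    then show ?thesis
      by (intro that[of K]) (force simp: abs_le_iff)+
  qed
  \<comment> \<open>\<open>D\<close> bounds the Dirichlet energy: the multiple |\<mu>| + Q/r of the
    squared norm costs a factor 1/\<epsilon> when expressed by the form norm. \<open>C\<close>
    inserts this into the sup estimate, with 1/(r \<epsilon>) from the unweighted norm of f and 1/p0
    from that of f'.\<close>
  define D where "D = 1 + (\<bar>\<mu>\<bar> + Q / r) / \<epsilon>"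
  define C where "C = ((1 + (b - a)) / (r * \<epsilon>) + (b - a) / p0 * D) / (b - a)"
  have "0 \<le> D"
    unfolding D_def using Q(1) r(1) eps_pos by (intro add_nonneg_nonneg divide_nonneg_nonneg) auto
  show ?thesis
  proof (intro exI[of _ C] conjI allI impI ballI)
    show "0 \<le> C"
      unfolding C_def using ab r(1) p0(1) eps_pos \<open>0 \<le> D\<close>
      by (intro add_nonneg_nonneg divide_nonneg_nonneg mult_nonneg_nonneg) auto
    fix F :: "nat set" and c :: "nat \<Rightarrow> real" and z
    assume F: "finite F" and z: "z \<in> {a..b}"
    \<comment> \<open>\<open>E\<close> is the squared form norm of the combination and
      \<open>S\<close> its squared weighted norm; the gap gives S \<le> E/\<epsilon>.\<close>
    define E where "E = (\<Sum>n\<in>F. (\<mu> - lam n) * (c n)\<^sup>2)"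
    define S where "S = (\<Sum>n\<in>F. (c n)\<^sup>2)"
    have "0 \<le> S" unfolding S_def by (intro sum_nonneg) simp
    have "\<epsilon> * S \<le> E"
      unfolding E_def S_def sum_distrib_left by (intro sum_mono mult_right_mono gap) simp
    then have S_le: "S \<le> E / \<epsilon>"
      using eps_pos by (simp add: field_simps)
    define f where "f z = (\<Sum>n\<in>F. c n * \<phi> n z)" for z
    define f' where "f' z = (\<Sum>n\<in>F. c n * deriv_on a b (\<phi> n) z)" for z
    define k where "k z = (\<Sum>n\<in>F. c n * ((lam n * \<rho> z + q z) * \<phi> n z))" for z
    have deriv_f: "(f has_real_derivative f' z) (at z within {a..b})" if "z \<in> {a..b}" for z
      unfolding f_def f'_def by (intro DERIV_sum DERIV_cmult deriv_phi that)
    have deriv_flux: "((\<lambda>z. p z * f' z) has_real_derivative k z) (at z within {a..b})" if "z \<in> {a..b}" for z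
    proof -
      have "((\<lambda>z. \<Sum>n\<in>F. c n * (p z * deriv_on a b (\<phi> n) z)) has_real_derivative k z) (at z within {a..b})"
        unfolding k_def by (intro DERIV_sum DERIV_cmult deriv_flux_phi that)
      then show ?thesis
        by (simp add: f'_def sum_distrib_left mult_ac)
    qed
    have cont_f: "continuous_on {a..b} f"
      unfolding f_def by (intro continuous_intros cont_phi)
    have cont_k: "continuous_on {a..b} k"
      unfolding k_def by (intro continuous_intros cont_phi cont_rho cont_q)
    note cont_f' = energy_identity(1)[OF deriv_f deriv_flux cont_k]
    have f_sq: "integral {a..b} (\<lambda>z. f z * f z * \<rho> z) = S"
      using nrm_sq_finite_sum[OF F, of c] ip_continuous[OF cont_f cont_f]
      by (simp add: nrm_sq f_def[abs_def] S_def)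
    have int_f_sq: "integral {a..b} (\<lambda>z. (f z)\<^sup>2) \<le> S / r"
    proof -
      have "integral {a..b} (\<lambda>z. (f z)\<^sup>2) \<le> integral {a..b} (\<lambda>z. 1 / r * (f z * f z * \<rho> z))"
      proof (rule integral_le)
        fix z assume "z \<in> {a..b}"
        then have "(f z)\<^sup>2 * r \<le> (f z)\<^sup>2 * \<rho> z"
          by (intro mult_left_mono r) auto
        then show "(f z)\<^sup>2 \<le> 1 / r * (f z * f z * \<rho> z)"
          using r(1) by (simp add: field_simps power2_eq_square)
      qed (intro integrable_continuous_real continuous_intros cont_f cont_rho)+
      then show ?thesis
        by (simp add: f_sq)
    qed
    have int_k: "(\<Sum>n\<in>F. lam n * (c n)\<^sup>2) - Q * (S / r) \<le> integral {a..b} (\<lambda>z. k z * f z)"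
    proof -
      \<comment> \<open>\<open>g\<close> is the operator applied to the finite combination: k =
        \<rho> g + q f. So the integral of k f is the diagonal sum of \<lambda>_n c_n^2 plus a
        potential term that is at least -Q times the integral of f^2.\<close>
      define g where "g z = (\<Sum>n\<in>F. (lam n * c n) * \<phi> n z)" for z
      have cont_g: "continuous_on {a..b} g"
        unfolding g_def by (intro continuous_intros cont_phi)
      have "ip g f = (\<Sum>n\<in>F. c n * coef g n)"
        unfolding f_def using finite_sum_L2[of "\<lambda>n. lam n * c n" F] by (intro ip_finite_sum) (simp add: g_def[abs_def])
      also have "\<dots> = (\<Sum>n\<in>F. lam n * (c n)\<^sup>2)"
        using coef_finite_sum[OF F, of "\<lambda>n. lam n * c n"]
        by (intro sum.cong) (simp_all add: g_def[abs_def] power2_eq_square)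
      finally have gf: "integral {a..b} (\<lambda>z. g z * f z * \<rho> z) = (\<Sum>n\<in>F. lam n * (c n)\<^sup>2)"
        by (simp add: ip_continuous[OF cont_g cont_f])
      have k_eq: "k z = g z * \<rho> z + q z * f z" for z
        by (simp add: k_def g_def f_def sum_distrib_left sum_distrib_right sum.distrib algebra_simps)
      have "integral {a..b} (\<lambda>z. g z * f z * \<rho> z - Q * (f z)\<^sup>2) \<le> integral {a..b} (\<lambda>z. k z * f z)"
      proof (rule integral_le)
        fix z assume "z \<in> {a..b}"
        then have "- q z * (f z)\<^sup>2 \<le> Q * (f z)\<^sup>2"
          by (intro mult_right_mono Q) auto
        then show "g z * f z * \<rho> z - Q * (f z)\<^sup>2 \<le> k z * f z"
          by (simp add: k_eq algebra_simps power2_eq_square)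
      qed (intro integrable_continuous_real continuous_intros cont_f cont_g cont_k cont_rho)+
      moreover have "integral {a..b} (\<lambda>z. g z * f z * \<rho> z - Q * (f z)\<^sup>2)
          = (\<Sum>n\<in>F. lam n * (c n)\<^sup>2) - Q * integral {a..b} (\<lambda>z. (f z)\<^sup>2)"
        by (subst Henstock_Kurzweil_Integration.integral_diff)
          (auto intro!: integrable_continuous_real continuous_intros cont_f cont_g cont_rho simp: gf)
      moreover have "Q * integral {a..b} (\<lambda>z. (f z)\<^sup>2) \<le> Q * (S / r)"
        by (intro mult_left_mono int_f_sq Q)
      ultimately show ?thesis by linarith
    qed
    have signs: "f' b * f b \<le> 0" "0 \<le> f' a * f a"
    proof -
      \<comment> \<open>The boundary conditions are linear and common to all eigenfunctions, so the
        combination inherits them.\<close>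
      have "\<alpha>a * deriv_on a b (\<phi> n) a + \<beta>a * \<phi> n a = 0" "\<alpha>b * deriv_on a b (\<phi> n) b + \<beta>b * \<phi> n b = 0" for n
        using phi_eigenfunction[of n] by (auto simp: eigenfunction_A_def SL_dom_def)
      then have "(\<Sum>n\<in>F. c n * (\<alpha>a * deriv_on a b (\<phi> n) a + \<beta>a * \<phi> n a)) = 0"
          "(\<Sum>n\<in>F. c n * (\<alpha>b * deriv_on a b (\<phi> n) b + \<beta>b * \<phi> n b)) = 0"
        by simp_all
      then have "\<alpha>a * f' a + \<beta>a * f a = 0" "\<alpha>b * f' b + \<beta>b * f b = 0"
        by (simp_all add: f_def f'_def sum_distrib_left sum.distrib algebra_simps)
      from boundary_signs[OF this] show "f' b * f b \<le> 0" "0 \<le> f' a * f a" .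
    qed
    have "p0 * integral {a..b} (\<lambda>z. (f' z)\<^sup>2) = integral {a..b} (\<lambda>z. p0 * (f' z)\<^sup>2)"
      by simp
    also have "\<dots> \<le> integral {a..b} (\<lambda>z. p z * (f' z)\<^sup>2)"
      by (intro integral_le mult_right_mono p0 integrable_continuous_real continuous_intros cont_f' cont_p) auto
    also have "\<dots> = p b * f' b * f b - p a * f' a * f a - integral {a..b} (\<lambda>z. k z * f z)"
      by (rule energy_identity(2)[OF deriv_f deriv_flux cont_k])
    also have "\<dots> \<le> - (\<Sum>n\<in>F. lam n * (c n)\<^sup>2) + Q * (S / r)"
    proof -
      have "p b * (f' b * f b) \<le> 0" "0 \<le> p a * (f' a * f a)"
        using signs p_pos[of a] p_pos[of b] ab by (auto simp: mult_le_0_iff)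
      then show ?thesis using int_k by (simp add: mult.assoc)
    qed
    also have "- (\<Sum>n\<in>F. lam n * (c n)\<^sup>2) = E - \<mu> * S"
      by (simp add: E_def S_def sum_distrib_left sum_subtractf left_diff_distrib)
    \<comment> \<open>The sign of \<mu> is left open, so -\<mu> is bounded by |\<mu>| before the gap
      absorbs \<open>S\<close>.\<close>
    also have "E - \<mu> * S + Q * (S / r) \<le> E + (\<bar>\<mu>\<bar> + Q / r) * S"
      using mult_right_mono[OF abs_ge_minus_self[of \<mu>] \<open>0 \<le> S\<close>] by (simp add: algebra_simps)
    also have "\<dots> \<le> E + (\<bar>\<mu>\<bar> + Q / r) * (E / \<epsilon>)"
      using Q(1) r(1) by (intro add_left_mono mult_left_mono S_le) auto
    also have "\<dots> = D * E"
      by (simp add: D_def algebra_simps add_divide_distrib)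
    finally have f'_sq: "integral {a..b} (\<lambda>z. (f' z)\<^sup>2) \<le> D * E / p0"
      using p0(1) by (simp add: pos_le_divide_eq mult.commute)
    have "(b - a) * (f z)\<^sup>2 \<le> (1 + (b - a)) * integral {a..b} (\<lambda>y. (f y)\<^sup>2) + (b - a) * integral {a..b} (\<lambda>y. (f' y)\<^sup>2)"
      by (rule sup_le_H1_norm[OF ab deriv_f cont_f' z])
    also have "\<dots> \<le> (1 + (b - a)) * ((E / \<epsilon>) / r) + (b - a) * (D * E / p0)"
    proof (intro add_mono mult_left_mono f'_sq)
      show "integral {a..b} (\<lambda>y. (f y)\<^sup>2) \<le> (E / \<epsilon>) / r"
        using int_f_sq divide_right_mono[OF S_le, of r] r(1) by simp
    qed (use ab in auto)
    also have "\<dots> = ((1 + (b - a)) / (r * \<epsilon>) + (b - a) / p0 * D) * E"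
      by (simp add: distrib_right mult.commute[of r])
    also have "\<dots> = (b - a) * (C * E)"
      using ab by (simp add: C_def)
    finally show "(\<Sum>n\<in>F. c n * \<phi> n z)\<^sup>2 \<le> C * (\<Sum>n\<in>F. (\<mu> - lam n) * (c n)\<^sup>2)"
      using ab by (simp add: f_def E_def)
  qed
qed

text \<open>Boundedness of evaluation on the form domain in dual form. For c_n =
  \<phi>_n(\<eta>)/(\<mu> - \<lambda>_n) the value at \<eta> and the squared form norm are the same
  number S, so S^2 \<le> C S bounds all partial sums. The series is the Green function of \<mu> - A
  on the diagonal.\<close>

lemma phi_sq_summable:
  assumes "\<eta> \<in> {a..b}"
  shows "summable (\<lambda>n. (\<phi> n \<eta>)\<^sup>2 / (\<mu> - lam n))"
proof -
  obtain C where C: "0 \<le> C" "\<And>F c z. finite F \<Longrightarrow> z \<in> {a..b} \<Longrightarrow>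
      (\<Sum>n\<in>F. c n * \<phi> n z)\<^sup>2 \<le> C * (\<Sum>n\<in>F. (\<mu> - lam n) * (c n)\<^sup>2)"
    using pointwise_bound by auto
  have "(\<Sum>n<N. (\<phi> n \<eta>)\<^sup>2 / (\<mu> - lam n)) \<le> C" for N
  proof -
    define S where "S = (\<Sum>n<N. (\<phi> n \<eta>)\<^sup>2 / (\<mu> - lam n))"
    have "0 \<le> S"
      unfolding S_def using gap_pos by (intro sum_nonneg) (simp add: less_imp_le)
    have "(\<Sum>n<N. \<phi> n \<eta> / (\<mu> - lam n) * \<phi> n \<eta>) = S"
      unfolding S_def by (intro sum.cong) (auto simp: power2_eq_square)
    moreover have "(\<Sum>n<N. (\<mu> - lam n) * (\<phi> n \<eta> / (\<mu> - lam n))\<^sup>2) = S"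
      unfolding S_def using gap_pos by (intro sum.cong) (auto simp: power2_eq_square order.strict_iff_not)
    ultimately have "S * S \<le> C * S"
      using C(2)[of "{..<N}" \<eta> "\<lambda>n. \<phi> n \<eta> / (\<mu> - lam n)"] assms by (simp add: power2_eq_square)
    with \<open>0 \<le> S\<close> C(1) have "S \<le> C"
      by (cases "S = 0") (auto simp: mult_le_cancel_right)
    then show ?thesis by (simp add: S_def)
  qed
  then show ?thesis
    using gap_pos by (intro summableI_nonneg_bounded) (simp_all add: less_imp_le)
qed

text \<open>Arithmetic-geometric mean, with the weight (\<mu> - \<lambda>_n)^(1/2) moved from one
  factor to the other.\<close>

lemma point_series_summable:
  assumes \<eta>: "\<eta> \<in> {a..b}" and c: "summable (\<lambda>n. (\<mu> - lam n) * (c n)\<^sup>2)"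
  shows "summable (\<lambda>n. \<bar>c n * \<phi> n \<eta>\<bar>)"
proof (rule summable_comparison_test'[OF summable_add[OF c phi_sq_summable[OF \<eta>]], of 0])
  fix n
  let ?s = "sqrt (\<mu> - lam n)"
  have s: "0 < ?s" "?s\<^sup>2 = \<mu> - lam n" using gap_pos[of n] by simp_all
  have "2 * (\<bar>c n\<bar> * ?s) * (\<bar>\<phi> n \<eta>\<bar> / ?s) \<le> (\<bar>c n\<bar> * ?s)\<^sup>2 + (\<bar>\<phi> n \<eta>\<bar> / ?s)\<^sup>2"
    by (rule sum_squares_bound)
  also have "\<dots> = (\<mu> - lam n) * (c n)\<^sup>2 + (\<phi> n \<eta>)\<^sup>2 / (\<mu> - lam n)"
    using s by (simp add: power_mult_distrib power_divide)
  also have "2 * (\<bar>c n\<bar> * ?s) * (\<bar>\<phi> n \<eta>\<bar> / ?s) = 2 * \<bar>c n * \<phi> n \<eta>\<bar>"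
    using s(1) by (simp add: abs_mult)
  finally show "norm \<bar>c n * \<phi> n \<eta>\<bar> \<le> (\<mu> - lam n) * (c n)\<^sup>2 + (\<phi> n \<eta>)\<^sup>2 / (\<mu> - lam n)"
    by simp
qed

text \<open>The uniform tail bound makes the pointwise sum a continuous function. Uniform
  convergence implies convergence in norm, so this function has the coefficients of x and is its
  continuous representative.\<close>

lemma point_obs_eq_series:
  assumes x: "x \<in> L2 a b" and summ: "summable (\<lambda>n. (\<mu> - lam n) * (coef x n)\<^sup>2)" and \<eta>: "\<eta> \<in> {a..b}"
  shows "point_obs a b \<eta> x = (\<Sum>n. coef x n * \<phi> n \<eta>)"
proof -
  obtain C where C: "0 \<le> C" "\<And>F c z. finite F \<Longrightarrow> z \<in> {a..b} \<Longrightarrow>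
      (\<Sum>n\<in>F. c n * \<phi> n z)\<^sup>2 \<le> C * (\<Sum>n\<in>F. (\<mu> - lam n) * (c n)\<^sup>2)"
    using pointwise_bound by auto
  define e where "e n = (\<mu> - lam n) * (coef x n)\<^sup>2" for n
  define B where "B N = C * (suminf e - (\<Sum>n<N. e n))" for N
  have e_nonneg: "0 \<le> e n" for n
    using gap_pos[of n] by (simp add: e_def less_imp_le)
  have e_summ: "summable e"
    using summ by (simp add: e_def[abs_def])
  have B0: "B \<longlonglongrightarrow> 0"
  proof -
    have "(\<lambda>N. C * (suminf e - (\<Sum>n<N. e n))) \<longlonglongrightarrow> C * (suminf e - suminf e)"
      by (intro tendsto_intros summable_LIMSEQ e_summ)
    then show ?thesis by (simp add: B_def[abs_def])
  qed
  define g where "g z = (\<Sum>n. coef x n * \<phi> n z)" for z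
  have lim: "(\<lambda>N. psum (coef x) N z) \<longlonglongrightarrow> g z" if "z \<in> {a..b}" for z
    unfolding g_def psum_def
    by (rule summable_LIMSEQ[OF summable_rabs_cancel[OF point_series_summable[OF that summ]]])
  \<comment> \<open>Each section from N to K is a finite combination, so the bound applies with a
    constant independent of z; then K tends to infinity.\<close>
  have bound: "(psum (coef x) N z - g z)\<^sup>2 \<le> B N" if z: "z \<in> {a..b}" for N z
  proof (rule tendsto_upperbound)
    show "(\<lambda>K. (psum (coef x) N z - psum (coef x) K z)\<^sup>2) \<longlonglongrightarrow> (psum (coef x) N z - g z)\<^sup>2"
      by (intro tendsto_intros lim z)
    show "\<forall>\<^sub>F K in sequentially. (psum (coef x) N z - psum (coef x) K z)\<^sup>2 \<le> B N"
    proof (rule eventually_sequentiallyI[of N])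
      fix K assume NK: "N \<le> K"
      have "psum (coef x) K z - psum (coef x) N z = (\<Sum>n\<in>{N..<K}. coef x n * \<phi> n z)"
        using NK by (simp add: psum_def sum_diff_nat_ivl flip: atLeast0LessThan)
      then have "(psum (coef x) N z - psum (coef x) K z)\<^sup>2 = (\<Sum>n\<in>{N..<K}. coef x n * \<phi> n z)\<^sup>2"
        by (metis power2_commute)
      also have "\<dots> \<le> C * (\<Sum>n\<in>{N..<K}. e n)"
        unfolding e_def by (intro C z) simp
      also have "(\<Sum>n\<in>{N..<K}. e n) = (\<Sum>n<K. e n) - (\<Sum>n<N. e n)"
        using NK by (simp add: sum_diff_nat_ivl flip: atLeast0LessThan)
      also have "C * \<dots> \<le> B N"
        unfolding B_def using sum_le_suminf[OF e_summ, of "{..<K}"] e_nonneg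
        by (intro mult_left_mono C(1)) auto
      finally show "(psum (coef x) N z - psum (coef x) K z)\<^sup>2 \<le> B N" .
    qed
  qed simp
  have "uniform_limit {a..b} (psum (coef x)) g sequentially"
  proof (rule uniform_limitI)
    fix d :: real assume "0 < d"
    then have "\<forall>\<^sub>F N in sequentially. B N < d\<^sup>2"
      by (intro order_tendstoD(2)[OF B0]) simp
    then show "\<forall>\<^sub>F N in sequentially. \<forall>z\<in>{a..b}. dist (psum (coef x) N z) (g z) < d"
    proof eventually_elim
      case (elim N)
      show ?case
      proof
        fix z assume "z \<in> {a..b}"
        then have "(psum (coef x) N z - g z)\<^sup>2 < d\<^sup>2"
          using bound elim le_less_trans by blast
        then show "dist (psum (coef x) N z) (g z) < d"
          using power2_less_imp_less[of "\<bar>psum (coef x) N z - g z\<bar>" d] \<open>0 < d\<close> by (simp add: dist_real_def)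
      qed
    qed
  qed
  then have cont_g: "continuous_on {a..b} g"
    by (rule uniform_limit_theorem[rotated])
      (auto intro!: always_eventually continuous_intros cont_phi simp: psum_def[abs_def])
  then have g: "g \<in> L2 a b"
    by (rule L2_continuous)
  have nrm_bound: "(nrm (\<lambda>z. psum (coef x) N z - g z))\<^sup>2 \<le> B N * integral\<^sup>L M \<rho>" for N
  proof -
    let ?h = "\<lambda>z. psum (coef x) N z - g z"
    have "(nrm ?h)\<^sup>2 = (LINT z|M. ?h z * ?h z * \<rho> z)"
      by (simp add: nrm_sq ip_rho_def)
    also have "\<dots> \<le> (LINT z|M. B N * \<rho> z)"
    proof (rule Bochner_Integration.integral_mono)
      show "integrable M (\<lambda>z. ?h z * ?h z * \<rho> z)"
        by (intro ip_integrable L2_diff psum_L2 g)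
      show "integrable M (\<lambda>z. B N * \<rho> z)"
        by (intro continuous_imp_integrable_real continuous_intros cont_rho)
      fix z assume "z \<in> space M"
      then show "?h z * ?h z * \<rho> z \<le> B N * \<rho> z"
        using bound[of z N] rho_pos[of z] by (intro mult_right_mono) (auto simp: power2_eq_square)
    qed
    also have "\<dots> = B N * integral\<^sup>L M \<rho>"
      by simp
    finally show ?thesis .
  qed
  have "(\<lambda>N. (nrm (\<lambda>z. psum (coef x) N z - g z))\<^sup>2) \<longlonglongrightarrow> 0"
    by (rule tendsto_sandwich[OF _ _ tendsto_const tendsto_mult_left_zero[OF B0, of "integral\<^sup>L M \<rho>"]])
      (intro always_eventually allI zero_le_power2 nrm_bound)+
  then have "(\<lambda>N. sqrt ((nrm (\<lambda>z. psum (coef x) N z - g z))\<^sup>2)) \<longlonglongrightarrow> sqrt 0"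
    by (rule tendsto_real_sqrt)
  then have "(\<lambda>N. nrm (\<lambda>z. psum (coef x) N z - g z)) \<longlonglongrightarrow> 0"
    by (simp add: nrm_nonneg)
  then have "coef g n = coef x n" for n
    by (rule coef_eq_of_sums_in_norm[OF g])
  then have "ae_eq a b x g"
    by (intro ae_eqI_coef x g) simp
  then show ?thesis
    using point_obs_eqI[OF ab cont_g _ \<eta>] by (simp add: g_def)
qed

end

section \<open>Fractional powers\<close>

text \<open>The only regularity is a right derivative at 0, so the argument avoids differential
  equations: ln (\<kappa> h) / h tends to l, and \<kappa> t is a power of \<kappa> at arbitrarily
  small arguments. This also yields positivity of \<kappa> t.\<close>

lemma multiplicative_eq_exp:
  fixes \<kappa> :: "real \<Rightarrow> real"
  assumes \<kappa>0: "\<kappa> 0 = 1" and mult: "\<And>s t. 0 \<le> s \<Longrightarrow> 0 \<le> t \<Longrightarrow> \<kappa> (s + t) = \<kappa> s * \<kappa> t"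
    and deriv: "((\<lambda>h. (\<kappa> h - 1) / h) \<longlongrightarrow> l) (at_right 0)" and t: "0 \<le> t"
  shows "\<kappa> t = exp (l * t)"
proof (cases "t = 0")
  case False
  with t have t: "0 < t" by simp
  have pos: "\<forall>\<^sub>F h in at_right 0. (0::real) < h"
    by (simp add: eventually_at_right_less)
  have "((\<lambda>h. 1 + h * ((\<kappa> h - 1) / h)) \<longlongrightarrow> 1 + 0 * l) (at_right 0)"
    by (intro tendsto_intros deriv)
  moreover have "\<forall>\<^sub>F h in at_right 0. 1 + h * ((\<kappa> h - 1) / h) = \<kappa> h"
    using pos by eventually_elim simp
  ultimately have lim1: "(\<kappa> \<longlongrightarrow> 1) (at_right 0)"
    using Lim_transform_eventually by fastforce
  then have \<kappa>_pos: "\<forall>\<^sub>F h in at_right 0. 0 < \<kappa> h"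
    by (rule order_tendstoD) simp
  have "((\<lambda>h. ((\<kappa> h - 1) / h) / \<kappa> h) \<longlongrightarrow> l / 1) (at_right 0)"
    by (intro tendsto_divide deriv lim1) simp
  then have lower: "((\<lambda>h. ((\<kappa> h - 1) / h) / \<kappa> h) \<longlongrightarrow> l) (at_right 0)" by simp
  \<comment> \<open>Sandwich from 1 - 1/x \<le> ln x \<le> x - 1 at x = \<kappa> h.\<close>
  have ln_lim: "((\<lambda>h. ln (\<kappa> h) / h) \<longlongrightarrow> l) (at_right 0)"
  proof (rule tendsto_sandwich[OF _ _ lower deriv])
    show "\<forall>\<^sub>F h in at_right 0. ((\<kappa> h - 1) / h) / \<kappa> h \<le> ln (\<kappa> h) / h"
      using pos \<kappa>_pos
    proof eventually_elim
      case (elim h)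
      have "- ln (\<kappa> h) \<le> 1 / \<kappa> h - 1"
        using ln_le_minus_one[of "1 / \<kappa> h"] elim by (simp add: ln_div)
      then have "(\<kappa> h - 1) / \<kappa> h \<le> ln (\<kappa> h)"
        using elim by (simp add: diff_divide_distrib)
      then have "((\<kappa> h - 1) / \<kappa> h) / h \<le> ln (\<kappa> h) / h"
        using elim by (intro divide_right_mono) auto
      then show ?case by (simp add: mult.commute)
    qed
    show "\<forall>\<^sub>F h in at_right 0. ln (\<kappa> h) / h \<le> (\<kappa> h - 1) / h"
      using pos \<kappa>_pos
      by eventually_elim (intro divide_right_mono ln_le_minus_one, auto)
  qed
  define h where "h k = t / real (Suc k)" for k
  have h_pos: "0 < h k" for k using t by (simp add: h_def)
  have "h \<longlonglongrightarrow> 0"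
    unfolding h_def by (rule LIMSEQ_Suc[OF lim_const_over_n])
  then have h_lim: "filterlim h (at_right 0) sequentially"
    using h_pos by (intro filterlim_atI tendsto_imp_filterlim_at_right) auto
  have pow: "\<kappa> (real n * s) = \<kappa> s ^ n" if "0 \<le> s" for n s
  proof (induction n)
    case (Suc n)
    have "\<kappa> (s + real n * s) = \<kappa> s * \<kappa> (real n * s)"
      using that by (intro mult) auto
    then show ?case
      using Suc by (simp add: distrib_right)
  qed (simp add: \<kappa>0)
  have t_eq: "\<kappa> t = \<kappa> (h k) ^ Suc k" for k
    using pow[of "h k" "Suc k"] h_pos[of k] by (simp add: h_def)
  have ev: "\<forall>\<^sub>F k in sequentially. 0 < \<kappa> (h k)"
    by (rule eventually_compose_filterlim[OF \<kappa>_pos h_lim])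
  then obtain k where "0 < \<kappa> (h k)"
    by (meson eventually_happens trivial_limit_sequentially)
  then have "0 < \<kappa> t"
    unfolding t_eq[of k] by simp
  have "(\<lambda>k. t * (ln (\<kappa> (h k)) / h k)) \<longlonglongrightarrow> t * l"
    by (intro tendsto_mult tendsto_const filterlim_compose[OF ln_lim h_lim])
  moreover have "\<forall>\<^sub>F k in sequentially. t * (ln (\<kappa> (h k)) / h k) = ln (\<kappa> t)"
    using ev
  proof eventually_elim
    case (elim k)
    have "t * (ln (\<kappa> (h k)) / h k) = real (Suc k) * ln (\<kappa> (h k))"
      using t by (simp add: h_def field_simps)
    also have "\<dots> = ln (\<kappa> t)"
      unfolding t_eq[of k] by (rule ln_realpow[symmetric])
    finally show ?case .
  qed
  ultimately have "(\<lambda>k. ln (\<kappa> t)) \<longlonglongrightarrow> t * l"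
    by (rule Lim_transform_eventually)
  then have "ln (\<kappa> t) = l * t"
    by (simp add: LIMSEQ_const_iff mult.commute)
  then show ?thesis
    using \<open>0 < \<kappa> t\<close> by (metis exp_ln)
qed (simp add: \<kappa>0)

section \<open>Diagonal calculus on a weighted sequence space\<close>

locale fractional_scale = weighted_L2_basis +
  fixes lam :: "nat \<Rightarrow> real" and \<mu> \<epsilon> \<alpha> :: real
  assumes eps_pos: "0 < \<epsilon>" and gap: "\<And>n. \<epsilon> \<le> \<mu> - lam n" and alpha_nonneg: "0 \<le> \<alpha>"
begin

abbreviation "X \<equiv> X_frac a b \<rho> lam \<phi> \<mu> \<alpha>"
abbreviation "nf \<equiv> norm_frac a b \<rho> lam \<phi> \<mu> \<alpha>"
abbreviation "domA \<equiv> dom_A_frac a b \<rho> lam \<phi> \<mu> \<alpha>"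
abbreviation "A \<equiv> A_frac a b \<rho> lam \<phi> \<mu> \<alpha>"

definition w :: "nat \<Rightarrow> real" where "w n = (\<mu> - lam n) powr \<alpha>"

lemma gap_pos: "0 < \<mu> - lam n"
  using gap[of n] eps_pos by simp

lemma w_pos: "0 < w n"
  using gap_pos[of n] by (simp add: w_def)

text \<open>Weights bounded away from 0 turn weighted square summability into plain square
  summability, which places the candidate for \<open>A f\<close> in \<open>L2\<close>.\<close>

lemma w_ge: "\<epsilon> powr \<alpha> \<le> w n"
  unfolding w_def using gap[of n] eps_pos alpha_nonneg by (intro powr_mono2) auto

lemma w_inverse: "w n * (\<mu> - lam n) powr (- \<alpha>) = 1"
  using gap_pos[of n] by (simp add: w_def flip: powr_add)

lemma X_iff: "f \<in> X \<longleftrightarrow> f \<in> L2 a b \<and> summable (\<lambda>n. (w n * coef f n)\<^sup>2)"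
proof -
  have "(\<mu> - lam n) powr (2 * \<alpha>) * (ip f (\<phi> n))\<^sup>2 = (w n * coef f n)\<^sup>2" for n
  proof -
    have "(\<mu> - lam n) powr (2 * \<alpha>) = (w n)\<^sup>2"
      by (simp add: w_def power2_eq_square flip: powr_add)
    then show ?thesis by (simp add: coef_def power_mult_distrib)
  qed
  then show ?thesis by (simp add: X_frac_def)
qed

lemma X_L2: "f \<in> X \<Longrightarrow> f \<in> L2 a b"
  by (simp add: X_iff)

lemma X_lincomb:
  assumes f: "f \<in> X" and g: "g \<in> X"
  shows "(\<lambda>z. c * f z + d * g z) \<in> X"
proof -
  note L2 = f[THEN X_L2] g[THEN X_L2]
  have "summable (\<lambda>n. 2 * c\<^sup>2 * (w n * coef f n)\<^sup>2 + 2 * d\<^sup>2 * (w n * coef g n)\<^sup>2)"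
    using f g by (intro summable_add summable_mult) (auto simp: X_iff)
  then have "summable (\<lambda>n. (w n * coef (\<lambda>z. c * f z + d * g z) n)\<^sup>2)"
  proof (rule summable_comparison_test'[of _ 0])
    fix n
    have "(w n * coef (\<lambda>z. c * f z + d * g z) n)\<^sup>2 = (c * (w n * coef f n) + d * (w n * coef g n))\<^sup>2"
      by (simp add: coef_lincomb[OF L2] algebra_simps)
    also have "\<dots> \<le> 2 * (c * (w n * coef f n))\<^sup>2 + 2 * (d * (w n * coef g n))\<^sup>2"
      using sum_squares_bound[of "c * (w n * coef f n)" "d * (w n * coef g n)"] by (simp add: power2_sum)
    finally show "norm ((w n * coef (\<lambda>z. c * f z + d * g z) n)\<^sup>2)
        \<le> 2 * c\<^sup>2 * (w n * coef f n)\<^sup>2 + 2 * d\<^sup>2 * (w n * coef g n)\<^sup>2"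
      by (simp add: power_mult_distrib)
  qed
  then show ?thesis
    using L2_lincomb[OF L2] by (simp add: X_iff)
qed

lemma X_scale: "f \<in> X \<Longrightarrow> (\<lambda>z. c * f z) \<in> X"
  using X_lincomb[of f f c 0] by simp

lemma X_diff: "f \<in> X \<Longrightarrow> g \<in> X \<Longrightarrow> (\<lambda>z. f z - g z) \<in> X"
  using X_lincomb[of f g 1 "-1"] by simp

lemma psum_X: "psum d N \<in> X"
proof -
  have "summable (\<lambda>n. (w n * coef (psum d N) n)\<^sup>2)"
    by (rule summable_finite[of "{..<N}"]) (simp_all add: coef_psum)
  then show ?thesis by (simp add: X_iff psum_L2)
qed

lemma phi_X: "\<phi> n \<in> X"
proof -
  have "summable (\<lambda>m. (w m * coef (\<phi> n) m)\<^sup>2)"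
    by (rule summable_finite[of "{n}"]) (auto simp: coef_phi)
  then show ?thesis by (simp add: X_iff phi_L2)
qed

text \<open>Riesz-Fischer shows that the Hilbert choice has a witness; any witness has its
  coefficients prescribed by the series.\<close>

lemma frac_power_coef:
  assumes f: "f \<in> X"
  shows "frac_power a b \<rho> lam \<phi> \<mu> \<alpha> f \<in> L2 a b"
    and "coef (frac_power a b \<rho> lam \<phi> \<mu> \<alpha> f) n = w n * coef f n"
proof -
  let ?P = "\<lambda>g. g \<in> L2 a b \<and> (\<lambda>N. nrm (\<lambda>z. psum (\<lambda>n. w n * coef f n) N z - g z)) \<longlonglongrightarrow> 0"
  have eq: "frac_power a b \<rho> lam \<phi> \<mu> \<alpha> f = (SOME g. ?P g)"
    by (simp add: frac_power_def sums_in_norm_def psum_def w_def coef_def)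
  have "summable (\<lambda>n. (w n * coef f n)\<^sup>2)"
    using f by (simp add: X_iff)
  then have "\<exists>g. ?P g"
    using Riesz_Fischer by metis
  then have P: "?P (frac_power a b \<rho> lam \<phi> \<mu> \<alpha> f)"
    unfolding eq by (rule someI_ex)
  then show "frac_power a b \<rho> lam \<phi> \<mu> \<alpha> f \<in> L2 a b" by simp
  show "coef (frac_power a b \<rho> lam \<phi> \<mu> \<alpha> f) n = w n * coef f n"
    using P by (intro coef_eq_of_sums_in_norm) auto
qed

lemma nf_nonneg: "0 \<le> nf f"
  by (simp add: norm_frac_def ip_frac_def ip_self_nonneg)

text \<open>Parseval identifies the norm with that of a weighted l^2 space; norm computations below
  go through this identity.\<close>

lemma nf_sums: "f \<in> X \<Longrightarrow> (\<lambda>n. (w n * coef f n)\<^sup>2) sums (nf f)\<^sup>2"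
  using Parseval[OF frac_power_coef(1), of f]
  by (simp add: frac_power_coef(2) norm_frac_def ip_frac_def nrm_sq ip_self_nonneg)

lemma nf_cong:
  assumes "f \<in> X" "g \<in> X" "\<And>n. coef f n = coef g n"
  shows "nf f = nf g"
proof -
  have "(nf f)\<^sup>2 = (nf g)\<^sup>2"
    using nf_sums[OF assms(1)] nf_sums[OF assms(2)] unfolding assms(3) by (rule sums_unique2)
  then show ?thesis
    using nf_nonneg by (simp add: power2_eq_iff_nonneg)
qed

lemma coef_le_nf:
  assumes "f \<in> X"
  shows "w n * \<bar>coef f n\<bar> \<le> nf f"
proof (rule power2_le_imp_le)
  have "(\<Sum>n\<in>{n}. (w n * coef f n)\<^sup>2) \<le> (\<Sum>n. (w n * coef f n)\<^sup>2)"
    by (intro sum_le_suminf sums_summable[OF nf_sums[OF assms]]) auto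
  also have "\<dots> = (nf f)\<^sup>2"
    by (rule sums_unique[OF nf_sums[OF assms], symmetric])
  finally show "(w n * \<bar>coef f n\<bar>)\<^sup>2 \<le> (nf f)\<^sup>2"
    by (simp add: power_mult_distrib)
qed (rule nf_nonneg)

text \<open>Coefficients are continuous functionals. The filter is arbitrary because both partial
  sums and difference quotients as h tends to 0 from the right are treated.\<close>

lemma coef_eq_0_of_nf_tendsto_0:
  assumes "F \<noteq> bot" and lim: "((\<lambda>i. nf (u i)) \<longlongrightarrow> 0) F" and u: "\<forall>\<^sub>F i in F. u i \<in> X"
  shows "((\<lambda>i. coef (u i) n) \<longlongrightarrow> 0) F"
proof (rule Lim_null_comparison)
  show "((\<lambda>i. nf (u i) / w n) \<longlongrightarrow> 0) F"
    using tendsto_divide[OF lim tendsto_const, of "w n"] w_pos[of n] by simp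
  show "\<forall>\<^sub>F i in F. norm (coef (u i) n) \<le> nf (u i) / w n"
    using u
  proof eventually_elim
    case (elim i)
    then show ?case
      using coef_le_nf[OF elim, of n] w_pos[of n] by (simp add: pos_le_divide_eq mult.commute)
  qed
qed

lemma nf_psum_tendsto:
  assumes f: "f \<in> X"
  shows "(\<lambda>N. nf (\<lambda>z. psum (coef f) N z - f z)) \<longlonglongrightarrow> 0"
proof -
  let ?e = "\<lambda>n. (w n * coef f n)\<^sup>2"
  have eq: "(nf (\<lambda>z. psum (coef f) N z - f z))\<^sup>2 = (nf f)\<^sup>2 - (\<Sum>n<N. ?e n)" for N
  proof -
    have "(\<lambda>n. ?e n - (if n \<in> {..<N} then ?e n else 0)) sums ((nf f)\<^sup>2 - (\<Sum>n<N. ?e n))"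
      by (intro sums_diff nf_sums f sums_If_finite_set) simp
    moreover have "?e n - (if n \<in> {..<N} then ?e n else 0) = (w n * coef (\<lambda>z. psum (coef f) N z - f z) n)\<^sup>2" for n
      by (simp add: coef_diff psum_L2 X_L2 f coef_psum)
    ultimately have "(\<lambda>n. (w n * coef (\<lambda>z. psum (coef f) N z - f z) n)\<^sup>2) sums ((nf f)\<^sup>2 - (\<Sum>n<N. ?e n))"
      by simp
    then show ?thesis
      using nf_sums[OF X_diff[OF psum_X f]] sums_unique2 by blast
  qed
  have "(\<lambda>N. (nf f)\<^sup>2 - (\<Sum>n<N. ?e n)) \<longlonglongrightarrow> (nf f)\<^sup>2 - (nf f)\<^sup>2"
    using nf_sums[OF f] unfolding sums_def by (intro tendsto_diff tendsto_const)
  then have "(\<lambda>N. sqrt ((nf (\<lambda>z. psum (coef f) N z - f z))\<^sup>2)) \<longlonglongrightarrow> sqrt 0"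
    unfolding eq by (intro tendsto_real_sqrt) simp
  then show ?thesis by (simp add: nf_nonneg)
qed

lemma phi_frac_X: "phi_frac lam \<phi> \<mu> \<alpha> n \<in> X"
  using X_scale[OF phi_X] by (simp add: phi_frac_def[abs_def])

text \<open>The fractional power undoes the normalisation: it maps the n-th normalised vector back
  to \<open>\<phi> n\<close>, up to a null set.\<close>

lemma ip_frac_phi_frac:
  assumes f: "f \<in> X"
  shows "ip_frac a b \<rho> lam \<phi> \<mu> \<alpha> f (phi_frac lam \<phi> \<mu> \<alpha> n) = w n * coef f n"
proof -
  let ?G = "frac_power a b \<rho> lam \<phi> \<mu> \<alpha>"
  have "coef (?G (phi_frac lam \<phi> \<mu> \<alpha> n)) m = coef (\<phi> n) m" for m
    unfolding frac_power_coef(2)[OF phi_frac_X]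
    using w_inverse[of m] by (simp add: phi_frac_def[abs_def] coef_scale coef_phi)
  then have ae: "ae_eq a b (?G (phi_frac lam \<phi> \<mu> \<alpha> n)) (\<phi> n)"
    by (intro ae_eqI_coef frac_power_coef phi_frac_X phi_L2)
  have "ip (?G f) (?G (phi_frac lam \<phi> \<mu> \<alpha> n)) = ip (?G f) (\<phi> n)"
    unfolding ip_commute[of "?G f"]
    by (intro ip_cong_ae frac_power_coef f phi_frac_X phi_L2 ae)
  then show ?thesis
    using frac_power_coef(2)[OF f, of n] by (simp add: ip_frac_def coef_def)
qed

lemma dom_iff: "f \<in> domA \<longleftrightarrow> f \<in> X \<and> summable (\<lambda>n. (w n * (lam n * coef f n))\<^sup>2)"
proof -
  have "(lam n)\<^sup>2 * (w n * coef f n)\<^sup>2 = (w n * (lam n * coef f n))\<^sup>2" for n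
    by (simp add: power_mult_distrib)
  then show ?thesis
    by (auto simp: dom_A_frac_def ip_frac_phi_frac)
qed

text \<open>A witness for the Hilbert choice is found in the larger space by Riesz-Fischer and then
  recognised as an element of \<open>X\<close> by its coefficients; only afterwards can the series
  be summed in the stronger norm.\<close>

lemma A_coef:
  assumes f: "f \<in> domA"
  shows "A f \<in> X" and "coef (A f) n = lam n * coef f n"
proof -
  define d where "d n = lam n * coef f n" for n
  have fX: "f \<in> X" and wd: "summable (\<lambda>n. (w n * d n)\<^sup>2)"
    using f by (auto simp: dom_iff d_def)
  let ?P = "\<lambda>g. g \<in> X \<and> (\<lambda>N. nf (\<lambda>z. psum d N z - g z)) \<longlonglongrightarrow> 0"
  have summand: "lam n * (w n * coef f n) * ((\<mu> - lam n) powr (- \<alpha>) * \<phi> n z) = d n * \<phi> n z" for n z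
  proof -
    have "lam n * (w n * coef f n) * ((\<mu> - lam n) powr (- \<alpha>) * \<phi> n z)
        = (w n * (\<mu> - lam n) powr (- \<alpha>)) * (lam n * coef f n * \<phi> n z)"
      by (simp only: mult_ac)
    then show ?thesis by (simp add: w_inverse d_def)
  qed
  have eq: "A f = (SOME g. ?P g)"
    unfolding A_frac_def sums_in_norm_def psum_def ip_frac_phi_frac[OF fX] unfolding phi_frac_def summand ..
  have "summable (\<lambda>n. (d n)\<^sup>2)"
  proof (rule summable_comparison_test'[OF summable_divide[OF wd, of "(\<epsilon> powr \<alpha>)\<^sup>2"], of 0])
    fix n
    have "(\<epsilon> powr \<alpha>)\<^sup>2 * (d n)\<^sup>2 \<le> (w n)\<^sup>2 * (d n)\<^sup>2"
      using w_ge[of n] by (intro mult_right_mono power_mono) auto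
    then show "norm ((d n)\<^sup>2) \<le> (w n * d n)\<^sup>2 / (\<epsilon> powr \<alpha>)\<^sup>2"
      using eps_pos by (simp add: pos_le_divide_eq power_mult_distrib mult.commute)
  qed
  then obtain g where g: "g \<in> L2 a b" "(\<lambda>N. nrm (\<lambda>z. psum d N z - g z)) \<longlonglongrightarrow> 0"
    using Riesz_Fischer by metis
  have coef_g: "coef g = d"
    using coef_eq_of_sums_in_norm[OF g] by auto
  then have gX: "g \<in> X"
    using g(1) wd by (simp add: X_iff)
  have "\<exists>g. ?P g"
    using nf_psum_tendsto[OF gX] gX by (auto simp: coef_g)
  then have P: "?P (A f)"
    unfolding eq by (rule someI_ex)
  then show AX: "A f \<in> X" by simp
  have "(\<lambda>N. coef (\<lambda>z. psum d N z - A f z) n) \<longlonglongrightarrow> 0"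
    using P by (intro coef_eq_0_of_nf_tendsto_0 always_eventually allI X_diff psum_X) auto
  moreover have "\<forall>\<^sub>F N in sequentially. coef (\<lambda>z. psum d N z - A f z) n = d n - coef (A f) n"
    by (rule eventually_sequentiallyI[of "Suc n"]) (simp add: coef_diff psum_L2 X_L2 AX coef_psum)
  ultimately have "(\<lambda>N. d n - coef (A f) n) \<longlonglongrightarrow> 0"
    by (rule Lim_transform_eventually)
  then show "coef (A f) n = lam n * coef f n"
    by (simp add: LIMSEQ_const_iff d_def)
qed

end

section \<open>The semigroup\<close>

locale fractional_semigroup = fractional_scale +
  fixes T :: "real \<Rightarrow> (real \<Rightarrow> real) \<Rightarrow> real \<Rightarrow> real"
  assumes inj_lam: "inj lam" and gen: "generates_C0_semigroup a b X nf domA A T"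
begin

section \<open>The semigroup axioms read on coefficients\<close>

lemma T_X: "0 \<le> t \<Longrightarrow> x \<in> X \<Longrightarrow> T t x \<in> X"
  using gen by (auto simp: generates_C0_semigroup_def C0_semigroup_def)

lemma T_bound: "0 \<le> t \<Longrightarrow> \<exists>K. \<forall>x\<in>X. nf (T t x) \<le> K * nf x"
  using gen by (auto simp: generates_C0_semigroup_def C0_semigroup_def)

lemma generator_iff:
  "x \<in> X \<Longrightarrow> y \<in> X \<Longrightarrow>
    ((\<lambda>t. nf (\<lambda>z. (T t x z - x z) / t - y z)) \<longlongrightarrow> 0) (at_right 0) \<longleftrightarrow> x \<in> domA \<and> ae_eq a b y (A x)"
  using gen unfolding generates_C0_semigroup_def by blast

lemma T_lincomb_coef:
  assumes "0 \<le> t" "x \<in> X" "y \<in> X"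
  shows "coef (T t (\<lambda>z. c * x z + d * y z)) n = c * coef (T t x) n + d * coef (T t y) n"
proof -
  have "ae_eq a b (T t (\<lambda>z. c * x z + d * y z)) (\<lambda>z. c * T t x z + d * T t y z)"
    using gen assms by (auto simp: generates_C0_semigroup_def C0_semigroup_def)
  then have "coef (T t (\<lambda>z. c * x z + d * y z)) n = coef (\<lambda>z. c * T t x z + d * T t y z) n"
    by (intro coef_cong_ae L2_lincomb X_L2 T_X X_lincomb assms)
  then show ?thesis
    by (simp add: coef_lincomb X_L2 T_X assms)
qed

lemma T_scale_coef: "0 \<le> t \<Longrightarrow> x \<in> X \<Longrightarrow> coef (T t (\<lambda>z. c * x z)) n = c * coef (T t x) n"
  using T_lincomb_coef[of t x x c 0 n] by simp

lemma T_0_coef: "x \<in> X \<Longrightarrow> coef (T 0 x) n = coef x n"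
  using gen by (intro coef_cong_ae X_L2 T_X) (auto simp: generates_C0_semigroup_def C0_semigroup_def)

lemma T_add_coef: "0 \<le> s \<Longrightarrow> 0 \<le> t \<Longrightarrow> x \<in> X \<Longrightarrow> coef (T (s + t) x) n = coef (T s (T t x)) n"
  using gen by (intro coef_cong_ae X_L2 T_X) (auto simp: generates_C0_semigroup_def C0_semigroup_def)

text \<open>Well-definedness on classes: the difference of two representatives has norm 0, and
  boundedness of \<open>T t\<close> preserves this.\<close>

lemma T_coef_cong:
  assumes t: "0 \<le> t" and x: "x \<in> X" and y: "y \<in> X" and eq: "\<And>n. coef x n = coef y n"
  shows "coef (T t x) n = coef (T t y) n"
proof -
  let ?d = "\<lambda>z. 1 * x z + (- 1) * y z"
  have d: "?d \<in> X" by (intro X_lincomb x y)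
  have "(\<lambda>n. (w n * coef ?d n)\<^sup>2) sums 0"
    by (simp only: coef_lincomb[OF X_L2[OF x] X_L2[OF y]] eq) simp
  then have "nf ?d = 0"
    using sums_unique2[OF nf_sums[OF d]] by force
  moreover obtain K where "\<forall>x\<in>X. nf (T t x) \<le> K * nf x"
    using T_bound[OF t] by auto
  ultimately have "nf (T t ?d) \<le> 0"
    using d by fastforce
  then have "w n * \<bar>coef (T t ?d) n\<bar> \<le> 0"
    using coef_le_nf[OF T_X[OF t d], of n] by simp
  then have "coef (T t ?d) n = 0"
    using w_pos[of n] by (simp add: mult_le_0_iff)
  then show ?thesis
    unfolding T_lincomb_coef[OF t x y] by simp
qed

text \<open>The error of the difference quotient of the orbit of \<open>\<phi> n\<close> against its
  expected limit.\<close>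

definition dq :: "nat \<Rightarrow> real \<Rightarrow> real \<Rightarrow> real" where
  "dq n h z = (T h (\<phi> n) z - \<phi> n z) / h - lam n * \<phi> n z"

text \<open>The nested two-term shape, with the coefficients 1 and -1/h written out, lets the
  linearity laws of \<open>T\<close> and \<open>coef\<close> apply twice by rewriting.\<close>

lemma dq_lincomb:
  "dq n h = (\<lambda>z. 1 * ((1 / h) * T h (\<phi> n) z + (- 1 / h) * \<phi> n z) + (- lam n) * \<phi> n z)"
  by (rule ext) (simp add: dq_def diff_divide_distrib)

lemma dq_X: "0 \<le> h \<Longrightarrow> dq n h \<in> X"
  unfolding dq_lincomb by (intro X_lincomb T_X phi_X)

lemma dq_coef:
  "0 \<le> h \<Longrightarrow> coef (dq n h) m = (coef (T h (\<phi> n)) m - coef (\<phi> n) m) / h - lam n * coef (\<phi> n) m"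
  unfolding dq_lincomb
  by (subst coef_lincomb, intro X_L2 X_lincomb T_X phi_X, assumption, intro phi_L2,
      subst coef_lincomb, intro X_L2 T_X phi_X, assumption, intro phi_L2)
    (simp add: diff_divide_distrib)

lemma dq_T_coef:
  assumes "0 \<le> s" "0 \<le> h"
  shows "coef (T s (dq n h)) m
    = (coef (T s (T h (\<phi> n))) m - coef (T s (\<phi> n)) m) / h - lam n * coef (T s (\<phi> n)) m"
proof -
  have X: "T h (\<phi> n) \<in> X" "(\<lambda>z. (1 / h) * T h (\<phi> n) z + (- 1 / h) * \<phi> n z) \<in> X"
    by (intro X_lincomb T_X phi_X assms)+
  show ?thesis
    unfolding dq_lincomb T_lincomb_coef[OF assms(1) X(2) phi_X] T_lincomb_coef[OF assms(1) X(1) phi_X]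
    by (simp add: diff_divide_distrib)
qed

lemma phi_domA: "\<phi> n \<in> domA"
proof -
  have "summable (\<lambda>m. (w m * (lam m * coef (\<phi> n) m))\<^sup>2)"
    by (rule summable_finite[of "{n}"]) (auto simp: coef_phi)
  then show ?thesis by (simp add: dom_iff phi_X)
qed

text \<open>The generator characterisation read from domain membership to the limit, once
  \<open>A\<close> acts on \<open>\<phi> n\<close> as multiplication by \<open>lam n\<close> almost
  everywhere.\<close>

lemma dq_tendsto_0: "((\<lambda>h. nf (dq n h)) \<longlongrightarrow> 0) (at_right 0)"
proof -
  have "ae_eq a b (\<lambda>z. lam n * \<phi> n z) (A (\<phi> n))"
    by (intro ae_eqI_coef L2_scale phi_L2 X_L2 A_coef(1) phi_domA)
      (simp add: A_coef(2)[OF phi_domA] coef_scale coef_phi)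
  then show ?thesis
    using generator_iff[OF phi_X X_scale[OF phi_X], of n "lam n" n] phi_domA by (simp add: dq_def[abs_def])
qed

text \<open>
  \<open>T s\<close> commutes with the generator, so \<open>T s \<phi>\<^sub>n\<close> is again an eigenvector for \<open>\<lambda>\<^sub>n\<close>.
\<close>
lemma T_phi_offdiagonal:
  assumes s: "0 \<le> s" and "m \<noteq> n"
  shows "coef (T s (\<phi> n)) m = 0"
proof -
  let ?f = "T s (\<phi> n)"
  have fX: "?f \<in> X" by (intro T_X s phi_X)
  obtain K where K: "\<forall>x\<in>X. nf (T s x) \<le> K * nf x"
    using T_bound[OF s] by auto
  have pos: "\<forall>\<^sub>F h in at_right 0. (0::real) < h"
    by (simp add: eventually_at_right_less)
  \<comment> \<open>Both orders of composing \<open>T s\<close> and \<open>T h\<close> agree with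
    the time s + h, so the error for the shifted vector is \<open>T s\<close> applied to
    \<open>dq n h\<close>.\<close>
  have bound: "nf (\<lambda>z. (T h ?f z - ?f z) / h - lam n * ?f z) \<le> K * nf (dq n h)" if "0 < h" for h
  proof -
    let ?g = "\<lambda>z. 1 * ((1 / h) * T h ?f z + (- 1 / h) * ?f z) + (- lam n) * ?f z"
    have h: "0 \<le> h" using that by simp
    have X: "T h ?f \<in> X" "(\<lambda>z. (1 / h) * T h ?f z + (- 1 / h) * ?f z) \<in> X"
      by (intro X_lincomb T_X fX h)+
    have "coef ?g k = coef (T s (dq n h)) k" for k
    proof -
      have "coef (T h ?f) k = coef (T s (T h (\<phi> n))) k"
        using T_add_coef[OF h s phi_X, of n k] T_add_coef[OF s h phi_X, of n k] by (simp add: add.commute)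
      then show ?thesis
        unfolding dq_T_coef[OF s h] coef_lincomb[OF X_L2[OF X(2)] X_L2[OF fX]]
          coef_lincomb[OF X_L2[OF X(1)] X_L2[OF fX]]
        by (simp add: diff_divide_distrib)
    qed
    then have "nf ?g = nf (T s (dq n h))"
      by (intro nf_cong X_lincomb X fX T_X s h dq_X)
    also have "\<dots> \<le> K * nf (dq n h)"
      using K dq_X[OF h] by blast
    also have "?g = (\<lambda>z. (T h ?f z - ?f z) / h - lam n * ?f z)"
      by (rule ext) (simp add: diff_divide_distrib)
    finally show ?thesis .
  qed
  have "((\<lambda>h. nf (\<lambda>z. (T h ?f z - ?f z) / h - lam n * ?f z)) \<longlongrightarrow> 0) (at_right 0)"
  proof (rule tendsto_sandwich[OF _ _ tendsto_const])
    show "((\<lambda>h. K * nf (dq n h)) \<longlongrightarrow> 0) (at_right 0)"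
      using tendsto_mult_right_zero[OF dq_tendsto_0] .
    show "\<forall>\<^sub>F h in at_right 0. nf (\<lambda>z. (T h ?f z - ?f z) / h - lam n * ?f z) \<le> K * nf (dq n h)"
      using pos by eventually_elim (rule bound)
  qed (simp add: nf_nonneg)
  \<comment> \<open>Here the characterisation is read the other way: existence of the limit yields
    both domain membership and the eigenvalue equation.\<close>
  then have D: "?f \<in> domA" and ae: "ae_eq a b (\<lambda>z. lam n * ?f z) (A ?f)"
    using generator_iff[OF fX X_scale[OF fX], of "lam n"] by simp_all
  have "lam n * coef ?f m = coef (A ?f) m"
    using coef_cong_ae[OF _ _ ae, of m] by (simp add: coef_scale L2_scale X_L2 fX A_coef(1) D)
  also have "\<dots> = lam m * coef ?f m"
    by (rule A_coef(2)[OF D])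
  finally show ?thesis
    using inj_lam \<open>m \<noteq> n\<close> by (auto simp: inj_eq)
qed

text \<open>With the off-diagonal coefficients gone, \<open>T t\<close> multiplies
  \<open>\<phi> n\<close> by a scalar. The semigroup law makes this scalar multiplicative in t, and
  the generator gives its right derivative at 0.\<close>

lemma T_phi_diagonal:
  assumes t: "0 \<le> t"
  shows "coef (T t (\<phi> n)) n = exp (lam n * t)"
proof (rule multiplicative_eq_exp[OF _ _ _ t])
  show "coef (T 0 (\<phi> n)) n = 1"
    by (simp add: T_0_coef phi_X coef_phi)
  fix s t :: real assume st: "0 \<le> s" "0 \<le> t"
  have "coef (T t (\<phi> n)) m = coef (\<lambda>z. coef (T t (\<phi> n)) n * \<phi> n z) m" for m
    using T_phi_offdiagonal[OF st(2), of m n] by (auto simp: coef_scale coef_phi)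
  then have "coef (T s (T t (\<phi> n))) n = coef (T s (\<lambda>z. coef (T t (\<phi> n)) n * \<phi> n z)) n"
    by (intro T_coef_cong st T_X phi_X X_scale)
  then show "coef (T (s + t) (\<phi> n)) n = coef (T s (\<phi> n)) n * coef (T t (\<phi> n)) n"
    by (simp add: T_add_coef st phi_X T_scale_coef)
next
  have pos: "\<forall>\<^sub>F h in at_right 0. (0::real) < h"
    by (simp add: eventually_at_right_less)
  have "((\<lambda>h. coef (dq n h) n) \<longlongrightarrow> 0) (at_right 0)"
    using pos by (intro coef_eq_0_of_nf_tendsto_0 dq_tendsto_0) (auto elim!: eventually_mono intro: dq_X)
  moreover have "\<forall>\<^sub>F h in at_right 0. coef (dq n h) n = (coef (T h (\<phi> n)) n - 1) / h - lam n"
    using pos by eventually_elim (simp add: dq_coef coef_phi)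
  ultimately have "((\<lambda>h. (coef (T h (\<phi> n)) n - 1) / h - lam n) \<longlongrightarrow> 0) (at_right 0)"
    by (rule Lim_transform_eventually)
  then show "((\<lambda>h. (coef (T h (\<phi> n)) n - 1) / h) \<longlongrightarrow> lam n) (at_right 0)"
    by (simp add: LIM_zero_iff)
qed

text \<open>True on finite combinations; both sides are continuous in x for the norm of
  \<open>X\<close>, in which partial sums converge to x.\<close>

theorem T_coef:
  assumes t: "0 \<le> t" and x: "x \<in> X"
  shows "coef (T t x) m = exp (lam m * t) * coef x m"
proof -
  have T_psum: "coef (T t (psum d N)) m = (if m < N then d m * exp (lam m * t) else 0)" for d N
  proof (induction N)
    case 0
    have "psum d 0 = (\<lambda>z. 0 * \<phi> 0 z)"
      by (simp add: psum_def[abs_def])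
    then show ?case
      using T_scale_coef[OF t phi_X, of 0 0 m] by simp
  next
    case (Suc N)
    have "psum d (Suc N) = (\<lambda>z. 1 * psum d N z + d N * \<phi> N z)"
      by (simp add: psum_def[abs_def])
    then have "coef (T t (psum d (Suc N))) m = coef (T t (psum d N)) m + d N * coef (T t (\<phi> N)) m"
      using T_lincomb_coef[OF t psum_X phi_X, of 1 d N "d N" N m] by simp
    then show ?case
      using Suc T_phi_offdiagonal[OF t, of m N] T_phi_diagonal[OF t, of N]
      by (cases "m = N") (auto simp: less_Suc_eq)
  qed
  let ?r = "\<lambda>N z. 1 * psum (coef x) N z + (- 1) * x z"
  have rX: "?r N \<in> X" for N
    by (intro X_lincomb psum_X x)
  obtain K where K: "\<forall>x\<in>X. nf (T t x) \<le> K * nf x"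
    using T_bound[OF t] by auto
  have "(\<lambda>N. nf (T t (?r N))) \<longlonglongrightarrow> 0"
  proof (rule tendsto_sandwich[OF _ _ tendsto_const])
    have "(\<lambda>N. nf (?r N)) \<longlonglongrightarrow> 0"
      using nf_psum_tendsto[OF x] by simp
    then show "(\<lambda>N. K * nf (?r N)) \<longlonglongrightarrow> 0"
      by (rule tendsto_mult_right_zero)
    show "\<forall>\<^sub>F N in sequentially. nf (T t (?r N)) \<le> K * nf (?r N)"
      using K rX by (intro always_eventually allI) blast
  qed (simp add: nf_nonneg)
  then have "(\<lambda>N. coef (T t (?r N)) m) \<longlonglongrightarrow> 0"
    by (intro coef_eq_0_of_nf_tendsto_0 always_eventually allI T_X t rX) simp_all
  moreover have "\<forall>\<^sub>F N in sequentially. coef (T t (?r N)) m = coef x m * exp (lam m * t) - coef (T t x) m"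
    by (rule eventually_sequentiallyI[of "Suc m"]) (simp only: T_lincomb_coef[OF t psum_X x] T_psum, simp)
  ultimately have "(\<lambda>N. coef x m * exp (lam m * t) - coef (T t x) m) \<longlonglongrightarrow> 0"
    by (rule Lim_transform_eventually)
  then show ?thesis
    by (simp add: LIMSEQ_const_iff mult.commute)
qed

end

section \<open>Observability\<close>

theorem mainTheorem2:
  fixes a b \<alpha>a \<beta>a \<alpha>b \<beta>b \<gamma> \<epsilon> \<mu> \<alpha> \<eta> :: real
    and p q \<rho> :: "real \<Rightarrow> real"
    and lam :: "nat \<Rightarrow> real"
    and \<phi> :: "nat \<Rightarrow> real \<Rightarrow> real"
    and T :: "real \<Rightarrow> (real \<Rightarrow> real) \<Rightarrow> real \<Rightarrow> real"
  assumes "SL_coefficients a b p q \<rho>"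
    and "(\<alpha>a, \<beta>a) \<noteq> (0, 0)" and "(\<alpha>b, \<beta>b) \<noteq> (0, 0)"
    and "Dirichlet_bc \<alpha>a \<beta>a \<alpha>b \<beta>b \<or> Neumann_bc \<alpha>a \<beta>a \<alpha>b \<beta>b \<or> mixed_bc \<alpha>a \<beta>a \<alpha>b \<beta>b"
    and "eigensystem_A a b p q \<rho> \<alpha>a \<beta>a \<alpha>b \<beta>b lam \<phi>"
    and "orthonormal_basis_rho a b \<rho> \<phi>"
    and "\<And>n. lam n < \<gamma>" and "\<epsilon> > 0" and "\<mu> = \<gamma> + \<epsilon>"
    and "\<mu> > - Inf (q ` {a..b}) / Inf (\<rho> ` {a..b})"
    and "\<alpha> \<in> {1/2..1}"
    and "generates_C0_semigroup a b (X_frac a b \<rho> lam \<phi> \<mu> \<alpha>) (norm_frac a b \<rho> lam \<phi> \<mu> \<alpha>)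
           (dom_A_frac a b \<rho> lam \<phi> \<mu> \<alpha>) (A_frac a b \<rho> lam \<phi> \<mu> \<alpha>) T"
    and "\<eta> \<in> {a..b}"
  shows "approx_observable_inf a b (X_frac a b \<rho> lam \<phi> \<mu> \<alpha>) (point_obs a b \<eta>) T
           \<longleftrightarrow> (\<forall>n. \<phi> n \<eta> \<noteq> 0)"
proof -
  have gap: "\<epsilon> \<le> \<mu> - lam n" for n
    using assms(7)[of n] assms(9) by simp
  interpret SL: sturm_liouville_system a b p q \<rho> \<alpha>a \<beta>a \<alpha>b \<beta>b \<mu> \<epsilon> lam \<phi>
    using assms(1-6,8) gap by unfold_locales
  interpret FS: fractional_semigroup a b \<rho> \<phi> lam \<mu> \<epsilon> \<alpha> T
    using assms(5,8,11,12) gap by unfold_locales (auto simp: eigensystem_A_def)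
  \<comment> \<open>Here \<alpha> \<ge> 1/2 enters: the exponent 2\<alpha> - 1 is nonnegative, so
    that power of \<mu> - \<lambda>_n is at least \<open>?c\<close> and \<open>X\<close> embeds in
    the form domain.\<close>
  have X_half: "summable (\<lambda>n. (\<mu> - lam n) * (SL.coef x n)\<^sup>2)" if "x \<in> FS.X" for x
  proof (rule summable_comparison_test'[of _ 0])
    let ?c = "\<epsilon> powr (2 * \<alpha> - 1)"
    show "summable (\<lambda>n. (FS.w n * SL.coef x n)\<^sup>2 / ?c)"
      using that by (intro summable_divide) (simp add: FS.X_iff)
    fix n
    have pos: "0 < \<mu> - lam n" by (rule SL.gap_pos)
    have "(\<mu> - lam n) * ?c \<le> (\<mu> - lam n) powr 1 * (\<mu> - lam n) powr (2 * \<alpha> - 1)"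
      using gap[of n] pos assms(8,11) by (intro mult_mono powr_mono2) auto
    also have "\<dots> = (FS.w n)\<^sup>2"
      unfolding FS.w_def power2_eq_square powr_add[symmetric] by simp
    finally have "(\<mu> - lam n) * ?c * (SL.coef x n)\<^sup>2 \<le> (FS.w n)\<^sup>2 * (SL.coef x n)\<^sup>2"
      by (rule mult_right_mono) simp
    then show "norm ((\<mu> - lam n) * (SL.coef x n)\<^sup>2) \<le> (FS.w n * SL.coef x n)\<^sup>2 / ?c"
      using pos assms(8) by (simp add: pos_le_divide_eq power_mult_distrib abs_mult mult_ac)
  qed
  have obs: "point_obs a b \<eta> (T t x) = (\<Sum>n. exp (lam n * t) * SL.coef x n * \<phi> n \<eta>)"
    if "0 \<le> t" "x \<in> FS.X" for t x
    using SL.point_obs_eq_series[OF FS.X_L2 X_half assms(13)] FS.T_X[OF that] FS.T_coef[OF that] by simp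
  show ?thesis
  proof
    assume L: "approx_observable_inf a b FS.X (point_obs a b \<eta>) T"
    show "\<forall>n. \<phi> n \<eta> \<noteq> 0"
    proof (intro allI notI)
      \<comment> \<open>The unobserved state is \<open>\<phi> n\<close> itself: its other
        coefficients vanish, and the remaining term has the factor \<phi>_n(\<eta>). The horizon 1
        is arbitrary.\<close>
      fix n assume zero: "\<phi> n \<eta> = 0"
      have "point_obs a b \<eta> (T t (\<phi> n)) = 0" if "t \<in> {0..1}" for t
      proof -
        have term_0: "exp (lam m * t) * SL.coef (\<phi> n) m * \<phi> m \<eta> = 0" for m
          using zero by (auto simp: SL.coef_phi)
        have "0 \<le> t" using that by simp
        from obs[OF this FS.phi_X[of n]] show ?thesis
          unfolding term_0 by simp
      qed
      then have "ae_eq a b (\<phi> n) (\<lambda>_. 0)"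
        using L FS.phi_X[of n] zero_less_one
        unfolding approx_observable_inf_def approx_observable_on_def by blast
      then show False
        using SL.phi_eigenfunction[of n] by (simp add: eigenfunction_A_def)
    qed
  next
    assume nz: "\<forall>n. \<phi> n \<eta> \<noteq> 0"
    show "approx_observable_inf a b FS.X (point_obs a b \<eta>) T"
      unfolding approx_observable_inf_def approx_observable_on_def
    proof (intro allI impI ballI)
      fix \<tau> :: real and x
      assume \<tau>: "0 < \<tau>" and x: "x \<in> FS.X" and zero: "\<forall>t\<in>{0..\<tau>}. point_obs a b \<eta> (T t x) = 0"
      let ?d = "\<lambda>n. SL.coef x n * \<phi> n \<eta>"
      have d: "summable (\<lambda>n. \<bar>?d n\<bar>)"
        by (rule SL.point_series_summable[OF assms(13) X_half[OF x]])
      have inj: "inj (\<lambda>n. \<mu> - lam n)"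
        using FS.inj_lam by (auto simp: inj_def)
      have "(\<Sum>n. ?d n * exp (- (\<mu> - lam n) * t)) = 0" if t: "t \<in> {0..\<tau>}" for t
      proof -
        \<comment> \<open>The shift by \<mu> makes the exponents negative, as the uniqueness result
          demands; it costs only the factor exp(-\<mu> t), independent of n.\<close>
        have term_eq: "?d n * exp (- (\<mu> - lam n) * t) = exp (- \<mu> * t) * (exp (lam n * t) * SL.coef x n * \<phi> n \<eta>)" for n
          by (simp add: left_diff_distrib exp_diff exp_minus field_simps)
        have "summable (\<lambda>n. exp (lam n * t) * SL.coef x n * \<phi> n \<eta>)"
          using summable_rabs_cancel[OF SL.point_series_summable[OF assms(13) X_half[OF FS.T_X[of t, OF _ x]]]]
            FS.T_coef[of t, OF _ x] t by simp
        then have "(\<Sum>n. ?d n * exp (- (\<mu> - lam n) * t))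
            = exp (- \<mu> * t) * (\<Sum>n. exp (lam n * t) * SL.coef x n * \<phi> n \<eta>)"
          unfolding term_eq by (rule suminf_mult)
        also have "\<dots> = exp (- \<mu> * t) * point_obs a b \<eta> (T t x)"
          using obs[of t, OF _ x] t by simp
        finally show ?thesis
          using zero t by simp
      qed
      then have "?d n = 0" for n
        using SL.gap_pos by (intro exp_series_coeffs_eq_0[OF d inj _ \<tau>]) (auto simp: less_imp_le)
      then have coef_0: "SL.coef x n = 0" for n
        using nz by simp
      show "ae_eq a b x (\<lambda>_. 0)"
      proof (rule SL.ae_eqI_coef)
        show "SL.coef x n = SL.coef (\<lambda>_. 0) n" for n
          using coef_0 SL.coef_scale[of 0 x n] by simp
      qed (use x in \<open>auto intro: FS.X_L2 SL.L2_continuous\<close>)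
    qed
  qed
qed

end
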